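(* Fix $\ell\in\mathbb N_0$ and $p\ge 1$, and let $\mathcal S_\ell:\mathcal X_\ell^p\to\mathcal X_\ell^p$ (not necessarily linear) be the error propagation operator of an algebraic solver, i.e., the solver iterates satisfy $u_\ell^{k+1}-u_\ell^k=\mathcal S_\ell(u_\ell^\star-u_\ell^k)$. Assume that the solver is contractive, i.e., there exists $q\in(0,1)$ such that $$|||(I-\mathcal S_\ell)u_\ell|||\le q\,|||u_\ell|||\quad\text{for all }u_\ell\in\mathcal X_\ell^p .$$ Let $\mathbf B_\ell:\mathbb R^{N_\ell^p}\to\mathbb R^{N_\ell^p}$ denote the representation of $\mathcal S_\ell$ acting on coefficient vectors, i.e., $\chi_\ell^p(\mathcal S_\ell u_\ell)=\mathbf B_\ell[\mathbf A_\ell\chi_\ell^p(u_\ell)]$ for all $u_\ell\in\mathcal X_\ell^p$. Then the generalized preconditioned conjugate gradient method (GPCG) with preconditioner $\mathbf B_\ell$ applied to $\mathbf A_\ell\mathbf x_\ell^\star=\mathbf b_\ell$, with arbitrary initial guess $\widetilde{\mathbf x}_\ell^0\in\mathbb R^{N_\ell^p}$, yields iterates $\widetilde{\mathbf x}_\ell^k$ with $$|\mathbf x_\ell^\star-\widetilde{\mathbf x}_\ell^{k+1}|_{\mathbf A_\ell}\le q\,|\mathbf x_\ell^\star-\widetilde{\mathbf x}_\ell^{k}|_{\mathbf A_\ell}\quad\text{for all }k\in\mathbb N_0 .$$ For $u_\ell^\star=\sum_{j=1}^{N_\ell^p}(\mathbf x_\ell^\star)_j\varphi_{\ell,j}^p$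 and $\widetilde u_\ell^k=\sum_{j=1}^{N_\ell^p}(\widetilde{\mathbf x}_\ell^k)_j\varphi_{\ell,j}^p$, this translates to $|||u_\ell^\star-\widetilde u_\ell^{k+1}|||\le q\,|||u_\ell^\star-\widetilde u_\ell^k|||$ for all $k\in\mathbb N_0$.
   Context: Setting. Let $d\in\{1,2,3\}$, $\Omega\subset\mathbb R^d$ a bounded Lipschitz domain, $f\in L^2(\Omega)$, and $\mathbf K\in[L^\infty(\Omega)]^{d\times d}$ symmetric and uniformly positive definite. Set $a(v,w)=\int_\Omega\mathbf K\nabla v\cdot\nabla w\,dx$, $|||v|||=a(v,v)^{1/2}$, $F(v)=\int_\Omega fv\,dx$ on $H_0^1(\Omega)$. Let $\mathcal T_\ell$ be a conforming simplicial mesh of $\Omega$ (from a sequence of newest-vertex-bisection refinements of an initial mesh $\mathcal T_0$) and $\mathcal X_\ell^p=\{v\in H_0^1(\Omega): v|_T\text{ is a polynomial of degree}\le p\text{ for all }T\in\mathcal T_\ell\}$, with $N_\ell^p=\dim\mathcal X_\ell^p$ and a fixed basis $\{\varphi_{\ell,j}^p\}_{j=1}^{N_\ell^p}$. The Galerkin solution $u_\ell^\star\in\mathcal X_\ell^p$ satisfies $a(u_\ell^\star,v)=F(v)$ for all $v\in\mathcal X_\ell^p$. The Galerkin matrix is $(\mathbf A_\ell)_{jk}=a(\varphi_{\ell,j}^p,\varphi_{\ell,k}^p)$ (symmetric positive definite), $(\mathbf b_\ell)_j=F(\varphi_{\ell,j}^p)$, and $\mathbf x_\ell^\star$ solves $\mathbf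 A_\ell\mathbf x_\ell^\star=\mathbf b_\ell$. The map $\chi_\ell^p:\mathcal X_\ell^p\to\mathbb R^{N_\ell^p}$ sends a function to its coefficient vector. We write $(\mathbf x,\mathbf y)_2=\mathbf x^T\mathbf y$ and $|\mathbf x|_{\mathbf A_\ell}^2=\mathbf x^T\mathbf A_\ell\mathbf x$; hence $|||v|||=|\chi_\ell^p(v)|_{\mathbf A_\ell}$. GPCG. Given a (possibly nonlinear) map $\mathbf B:\mathbb R^N\to\mathbb R^N$, an SPD matrix $\mathbf A$, a right-hand side $\mathbf b$ and an initial guess $\mathbf x^0$, set $\mathbf r^0=\mathbf b-\mathbf A\mathbf x^0$, $\mathbf p^0=\mathbf B[\mathbf r^0]$, and for $k=0,1,2,\dots$: (i) $\mathbf x^{k+1}=\mathbf x^k+\alpha_k\mathbf p^k$ with $\alpha_k=(\mathbf B[\mathbf r^k],\mathbf r^k)_2/|\mathbf p^k|_{\mathbf A}^2$; (ii) $\mathbf r^{k+1}=\mathbf r^k-\alpha_k\mathbf A\mathbf p^k$; (iii) $\mathbf p^{k+1}=\mathbf B[\mathbf r^{k+1}]+\beta_k\mathbf p^k$ with $\beta_k=\dfrac{(\mathbf B[\mathbf r^{k+1}],\mathbf r^{k+1})_2-(\mathbf B[\mathbf r^{k+1}],\mathbf r^k)_2}{(\mathbf B[\mathbf r^k],\mathbf r^k)_2}$. Convention: if $\mathbf r^k=0$, the iteration stops and $\mathbf x^{j}=\mathbf x^k$ for all $j\ge k$. *)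

theory Defs
  imports "HOL-Analysis.Analysis" "Jordan_Normal_Form.Matrix"
begin

(* The symbol $ is kept for components of points of real^'d; coefficient vectors are
   Jordan_Normal_Form vectors of run-time dimension N, since N = dim X may be 0. *)
no_notation Matrix.vec_index (infixl "$" 100)

section \<open>Domain and coefficient\<close>

(* Lipschitz boundary: near every boundary point, Omega is the strict epigraph, in some
   direction e, of a Lipschitz function of the component orthogonal to e. *)
definition bounded_lipschitz_domain :: "(real^'d) set \<Rightarrow> bool" where
  "bounded_lipschitz_domain \<Omega> \<longleftrightarrow>
     open \<Omega> \<and> connected \<Omega> \<and> \<Omega> \<noteq> {} \<and> bounded \<Omega> \<and>
     (\<forall>z\<in>frontier \<Omega>. \<exists>e \<gamma> L r. norm e = 1 \<and> 0 < r \<and>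
        L-lipschitz_on {y. inner y e = 0} \<gamma> \<and>
        (\<forall>x\<in>ball z r. x \<in> \<Omega> \<longleftrightarrow> inner x e > \<gamma> (x - inner x e *\<^sub>R e)))"

definition L2 :: "(real^'d) set \<Rightarrow> (real^'d \<Rightarrow> 'b::euclidean_space) set" where
  "L2 \<Omega> = {f \<in> borel_measurable (lebesgue_on \<Omega>).
             integrable (lebesgue_on \<Omega>) (\<lambda>x. (norm (f x))\<^sup>2)}"

definition Linfty_matrix :: "(real^'d) set \<Rightarrow> (real^'d \<Rightarrow> real^'d^'d) \<Rightarrow> bool" where
  "Linfty_matrix \<Omega> K \<longleftrightarrow>
     (\<forall>i j. (\<lambda>x. K x $ i $ j) \<in> borel_measurable (lebesgue_on \<Omega>) \<and>
            (\<exists>C. AE x in lebesgue_on \<Omega>. \<bar>K x $ i $ j\<bar> \<le> C))"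

definition sym_unif_pos_def :: "(real^'d) set \<Rightarrow> (real^'d \<Rightarrow> real^'d^'d) \<Rightarrow> bool" where
  "sym_unif_pos_def \<Omega> K \<longleftrightarrow>
     (AE x in lebesgue_on \<Omega>. Finite_Cartesian_Product.transpose (K x) = K x) \<and>
     (\<exists>\<kappa>>0. AE x in lebesgue_on \<Omega>. \<forall>\<xi>. \<kappa> * (norm \<xi>)\<^sup>2 \<le> inner (K x *v \<xi>) \<xi>)"

section \<open>Sobolev spaces\<close>

(* Elements of L2, H1, H10 and of the finite element space are represented by functions
   real^'d => real; two functions that agree almost everywhere on Omega represent the same
   element, and values outside Omega are irrelevant. *)

definition partial_deriv :: "'d \<Rightarrow> (real^'d \<Rightarrow> real) \<Rightarrow> real^'d \<Rightarrow> real" where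
  "partial_deriv i f x = frechet_derivative f (at x) (axis i 1)"

definition gradient :: "(real^'d \<Rightarrow> real) \<Rightarrow> real^'d \<Rightarrow> real^'d" where
  "gradient f x = (\<chi> i. partial_deriv i f x)"

primrec Ck :: "nat \<Rightarrow> (real^'d \<Rightarrow> real) \<Rightarrow> bool" where
  "Ck 0 f \<longleftrightarrow> continuous_on UNIV f"
| "Ck (Suc k) f \<longleftrightarrow> (\<forall>x. f differentiable (at x)) \<and> (\<forall>i. Ck k (partial_deriv i f))"

definition test_functions :: "(real^'d) set \<Rightarrow> (real^'d \<Rightarrow> real) set" where
  "test_functions \<Omega> = {\<psi>. (\<forall>k. Ck k \<psi>) \<and> (\<exists>S. compact S \<and> S \<subseteq> \<Omega> \<and> (\<forall>x. x \<notin> S \<longrightarrow> \<psi> x = 0))}"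

definition has_weak_grad :: "(real^'d) set \<Rightarrow> (real^'d \<Rightarrow> real) \<Rightarrow> (real^'d \<Rightarrow> real^'d) \<Rightarrow> bool" where
  "has_weak_grad \<Omega> v g \<longleftrightarrow>
     (\<forall>\<psi>\<in>test_functions \<Omega>. \<forall>i.
        (LINT x|lebesgue_on \<Omega>. v x * partial_deriv i \<psi> x) = - (LINT x|lebesgue_on \<Omega>. g x $ i * \<psi> x))"

definition H1 :: "(real^'d) set \<Rightarrow> (real^'d \<Rightarrow> real) set" where
  "H1 \<Omega> = {v \<in> L2 \<Omega>. \<exists>g\<in>L2 \<Omega>. has_weak_grad \<Omega> v g}"

(* Weak gradients are unique up to null sets, so the choice is immaterial. *)
definition weak_grad :: "(real^'d) set \<Rightarrow> (real^'d \<Rightarrow> real) \<Rightarrow> real^'d \<Rightarrow> real^'d" where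
  "weak_grad \<Omega> v = (SOME g. g \<in> L2 \<Omega> \<and> has_weak_grad \<Omega> v g)"

(* Closure of the test functions in the H1 norm. *)
definition H10 :: "(real^'d) set \<Rightarrow> (real^'d \<Rightarrow> real) set" where
  "H10 \<Omega> = {v \<in> H1 \<Omega>. \<forall>\<epsilon>>0. \<exists>\<psi>\<in>test_functions \<Omega>.
      sqrt ((LINT x|lebesgue_on \<Omega>. (v x - \<psi> x)\<^sup>2) +
            (LINT x|lebesgue_on \<Omega>. (norm (weak_grad \<Omega> v x - gradient \<psi> x))\<^sup>2)) < \<epsilon>}"

definition energy_form ::
  "(real^'d) set \<Rightarrow> (real^'d \<Rightarrow> real^'d^'d) \<Rightarrow> (real^'d \<Rightarrow> real) \<Rightarrow> (real^'d \<Rightarrow> real) \<Rightarrow> real" where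
  "energy_form \<Omega> K v w = (LINT x|lebesgue_on \<Omega>. inner (K x *v weak_grad \<Omega> v x) (weak_grad \<Omega> w x))"

definition energy_norm ::
  "(real^'d) set \<Rightarrow> (real^'d \<Rightarrow> real^'d^'d) \<Rightarrow> (real^'d \<Rightarrow> real) \<Rightarrow> real" where
  "energy_norm \<Omega> K v = sqrt (energy_form \<Omega> K v v)"

definition load_functional ::
  "(real^'d) set \<Rightarrow> (real^'d \<Rightarrow> real) \<Rightarrow> (real^'d \<Rightarrow> real) \<Rightarrow> real" where
  "load_functional \<Omega> f v = (LINT x|lebesgue_on \<Omega>. f x * v x)"

section \<open>Meshes and newest vertex bisection\<close>

(* A tagged simplex ([z_0, ..., z_d], t) carries the vertex order and the type t < d used by
   newest vertex bisection in the form of Maubach and Stevenson; its refinement edge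
   joins z_0 and z_d. For d = 2 this is the usual newest vertex bisection. *)
type_synonym 'd tagged_simplex = "(real^'d) list \<times> nat"

definition tagged_simplex :: "('d::finite) tagged_simplex \<Rightarrow> bool" where
  "tagged_simplex s \<longleftrightarrow>
     length (fst s) = CARD('d) + 1 \<and> distinct (fst s) \<and> \<not> affine_dependent (set (fst s)) \<and>
     snd s < CARD('d)"

definition simplex_of :: "('d::finite) tagged_simplex \<Rightarrow> (real^'d) set" where
  "simplex_of s = convex hull (set (fst s))"

(* The children of (z_0, ..., z_d)_t with midpoint m of z_0 z_d are
   (z_0, m, z_1, ..., z_(d-1)) and (z_d, m, z_1, ..., z_t, z_(d-1), ..., z_(t+1)),
   both of type t + 1 modulo d. *)
definition bisect :: "('d::finite) tagged_simplex \<Rightarrow> 'd tagged_simplex set" where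
  "bisect s = (let zs = fst s; t = snd s; a = hd zs; b = last zs; m = midpoint a b;
                   inner_zs = butlast (tl zs); t' = Suc t mod CARD('d)
               in {(a # m # inner_zs, t'),
                   (b # m # take t inner_zs @ rev (drop t inner_zs), t')})"

definition bisection_step :: "('d::finite) tagged_simplex set \<Rightarrow> 'd tagged_simplex set \<Rightarrow> bool" where
  "bisection_step M M' \<longleftrightarrow> (\<exists>s\<in>M. M' = (M - {s}) \<union> bisect s)"

definition conforming_mesh :: "(real^'d) set \<Rightarrow> 'd tagged_simplex set \<Rightarrow> bool" where
  "conforming_mesh \<Omega> M \<longleftrightarrow>
     finite M \<and> (\<forall>s\<in>M. tagged_simplex s) \<and> inj_on simplex_of M \<and>
     triangulation (simplex_of ` M) \<and> \<Union>(simplex_of ` M) = closure \<Omega>"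

definition nvb_mesh_sequence :: "(real^'d) set \<Rightarrow> (nat \<Rightarrow> 'd tagged_simplex set) \<Rightarrow> bool" where
  "nvb_mesh_sequence \<Omega> \<T> \<longleftrightarrow>
     (\<forall>l. conforming_mesh \<Omega> (\<T> l)) \<and> (\<forall>l. bisection_step\<^sup>*\<^sup>* (\<T> l) (\<T> (Suc l)))"

section \<open>Finite element space and Galerkin system\<close>

definition polys_deg_le :: "nat \<Rightarrow> (real^'d \<Rightarrow> real) set" where
  "polys_deg_le p =
     {P. \<exists>c :: ('d \<Rightarrow> nat) \<Rightarrow> real.
           P = (\<lambda>x. \<Sum>\<alpha> | (\<Sum>i\<in>UNIV. \<alpha> i) \<le> p. c \<alpha> * (\<Prod>i\<in>UNIV. (x $ i) ^ \<alpha> i))}"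

definition fe_space :: "(real^'d) set \<Rightarrow> 'd tagged_simplex set \<Rightarrow> nat \<Rightarrow> (real^'d \<Rightarrow> real) set" where
  "fe_space \<Omega> M p =
     {v \<in> H10 \<Omega>. \<forall>s\<in>M. \<exists>P\<in>polys_deg_le p. AE x in lebesgue_on (simplex_of s). v x = P x}"

definition lin_comb :: "(nat \<Rightarrow> real^'d \<Rightarrow> real) \<Rightarrow> real Matrix.vec \<Rightarrow> real^'d \<Rightarrow> real" where
  "lin_comb \<phi> c x = (\<Sum>j<dim_vec c. vec_index c j * \<phi> j x)"

(* Spanning and linear independence, both modulo equality almost everywhere. *)
definition is_basis ::
  "(real^'d) set \<Rightarrow> (real^'d \<Rightarrow> real) set \<Rightarrow> nat \<Rightarrow> (nat \<Rightarrow> real^'d \<Rightarrow> real) \<Rightarrow> bool" where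
  "is_basis \<Omega> X N \<phi> \<longleftrightarrow>
     X = {v. \<exists>c\<in>carrier_vec N. AE x in lebesgue_on \<Omega>. v x = lin_comb \<phi> c x} \<and>
     (\<forall>c\<in>carrier_vec N. (AE x in lebesgue_on \<Omega>. lin_comb \<phi> c x = 0) \<longrightarrow> c = 0\<^sub>v N)"

definition coeff_vec ::
  "(real^'d) set \<Rightarrow> nat \<Rightarrow> (nat \<Rightarrow> real^'d \<Rightarrow> real) \<Rightarrow> (real^'d \<Rightarrow> real) \<Rightarrow> real Matrix.vec" where
  "coeff_vec \<Omega> N \<phi> v =
     (THE c. c \<in> carrier_vec N \<and> (AE x in lebesgue_on \<Omega>. v x = lin_comb \<phi> c x))"

definition galerkin_matrix ::
  "(real^'d) set \<Rightarrow> (real^'d \<Rightarrow> real^'d^'d) \<Rightarrow> nat \<Rightarrow> (nat \<Rightarrow> real^'d \<Rightarrow> real) \<Rightarrow> real Matrix.mat" where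
  "galerkin_matrix \<Omega> K N \<phi> = Matrix.mat N N (\<lambda>(j, k). energy_form \<Omega> K (\<phi> j) (\<phi> k))"

definition galerkin_rhs ::
  "(real^'d) set \<Rightarrow> (real^'d \<Rightarrow> real) \<Rightarrow> nat \<Rightarrow> (nat \<Rightarrow> real^'d \<Rightarrow> real) \<Rightarrow> real Matrix.vec" where
  "galerkin_rhs \<Omega> f N \<phi> = Matrix.vec N (\<lambda>j. load_functional \<Omega> f (\<phi> j))"

definition galerkin_solution ::
  "(real^'d) set \<Rightarrow> (real^'d \<Rightarrow> real^'d^'d) \<Rightarrow> (real^'d \<Rightarrow> real) \<Rightarrow> (real^'d \<Rightarrow> real) set \<Rightarrow>
   (real^'d \<Rightarrow> real) \<Rightarrow> bool" where
  "galerkin_solution \<Omega> K f X u \<longleftrightarrow>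
     u \<in> X \<and> (\<forall>v\<in>X. energy_form \<Omega> K u v = load_functional \<Omega> f v)"

section \<open>Generalized preconditioned conjugate gradients\<close>

definition mat_norm :: "real Matrix.mat \<Rightarrow> real Matrix.vec \<Rightarrow> real" where
  "mat_norm A x = sqrt (x \<bullet> (A *\<^sub>v x))"

(* The state is the triple (x, r, p). Once r = 0 the iteration is stationary. *)
definition gpcg_step ::
  "real Matrix.mat \<Rightarrow> (real Matrix.vec \<Rightarrow> real Matrix.vec) \<Rightarrow>
   real Matrix.vec \<times> real Matrix.vec \<times> real Matrix.vec \<Rightarrow>
   real Matrix.vec \<times> real Matrix.vec \<times> real Matrix.vec" where
  "gpcg_step A B = (\<lambda>(x, r, p).
     if r = 0\<^sub>v (dim_row A) then (x, r, p)
     else let \<alpha> = (B r \<bullet> r) / (mat_norm A p)\<^sup>2;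
              r' = r - \<alpha> \<cdot>\<^sub>v (A *\<^sub>v p);
              \<beta> = (B r' \<bullet> r' - B r' \<bullet> r) / (B r \<bullet> r)
          in (x + \<alpha> \<cdot>\<^sub>v p, r', B r' + \<beta> \<cdot>\<^sub>v p))"

definition gpcg ::
  "real Matrix.mat \<Rightarrow> (real Matrix.vec \<Rightarrow> real Matrix.vec) \<Rightarrow> real Matrix.vec \<Rightarrow> real Matrix.vec \<Rightarrow>
   nat \<Rightarrow> real Matrix.vec \<times> real Matrix.vec \<times> real Matrix.vec" where
  "gpcg A B b x0 k =
     (gpcg_step A B ^^ k) (x0, b - A *\<^sub>v x0, B (b - A *\<^sub>v x0))"

definition gpcg_iterate where
  "gpcg_iterate A B b x0 k = fst (gpcg A B b x0 k)"

(* No division by zero before the stopping criterion r = 0 is met; this has to be said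
   explicitly because x / 0 = 0 in HOL. *)
definition gpcg_well_defined where
  "gpcg_well_defined A B b x0 \<longleftrightarrow>
     (\<forall>k. case gpcg A B b x0 k of (x, r, p) \<Rightarrow>
        r \<noteq> 0\<^sub>v (dim_row A) \<longrightarrow> mat_norm A p \<noteq> 0 \<and> B r \<bullet> r \<noteq> 0)"

end

theory Submission
  imports Defs
begin

text \<open>
The heart of the matter is linear algebra. Write \<open>e\<close> for the error, \<open>r = A e\<close> for the residual, and measure
everything in the inner product of \<open>A\<close>. In coefficients, contractivity of the solver reads
\<open>|c - B (A c)| \<le> q |c|\<close>, so one step of the solver from the current iterate would have error
\<open>|e - B r| \<le> q |e|\<close>. The search direction \<open>p\<close> of the conjugate gradient method is \<open>B r\<close> plus a
multiple of the previous direction, and this multiple is orthogonal to \<open>p\<close> and to \<open>e\<close>. By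
Pythagoras, \<open>|e - p| \<le> |e - B r|\<close>. The method minimizes the error on the line through the
iterate in direction \<open>p\<close>, and so its new error is at most \<open>|e - p|\<close>. The two orthogonality
relations are the invariant \<open>conjugate_state\<close>, preserved by \<open>gpcg_step_conjugate_state\<close>, and
\<open>gpcg_contraction\<close> collects the result. Contractivity with \<open>q < 1\<close> also forces \<open>(B r, r) > 0\<close> as long as
\<open>r\<close> is nonzero, so that no division by zero can occur.

What remains is the link between functions and coefficients: the Galerkin matrix represents the energy
form on the finite element space (\<open>energy_form_lin_comb\<close>) and is symmetric positive definite.
Bilinearity of the form requires linearity of the weak gradient, which is chosen arbitrarily among its
representatives. It is thus a matter of uniqueness almost everywhere, and rests on the fundamental
lemma of the calculus of variations, proved with explicit smooth cut-offs of boxes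
(\<open>fundamental_lemma\<close>). Definiteness comes down to the fact that an element of \<open>H10\<close> whose weak gradient
vanishes is itself zero (\<open>H10_weak_grad_zero\<close>).
\<close>

(* In the section on matrices this symbol denotes the scalar product of coefficient vectors. *)
no_notation inner (infix "\<bullet>" 70)

section \<open>Smooth cut-off functions\<close>

lemma partial_deriv_eq: "(f has_derivative D) (at x) \<Longrightarrow> partial_deriv i f x = D (axis i 1)"
  using frechet_derivative_at[of f D x] by (simp add: partial_deriv_def)

lemma Ck_SucI:
  assumes "\<And>x. (f has_derivative D x) (at x)" "\<And>i. Ck k (\<lambda>x. D x (axis i 1))"
  shows "Ck (Suc k) f"
proof -
  have "partial_deriv i f = (\<lambda>x. D x (axis i 1))" for i
    using assms(1) by (auto simp: partial_deriv_eq)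
  then show ?thesis
    using assms by (auto simp: differentiable_def)
qed

lemma Ck_Suc_has_derivative:
  "Ck (Suc k) f \<Longrightarrow> (f has_derivative frechet_derivative f (at x)) (at x)"
  by (simp add: frechet_derivative_works)

lemma Ck_continuous: "Ck k f \<Longrightarrow> continuous_on UNIV f"
  by (cases k) (auto intro!: continuous_at_imp_continuous_on differentiable_imp_continuous_within)

lemma Ck_Suc_imp: "Ck (Suc k) f \<Longrightarrow> Ck k f"
proof (induction k arbitrary: f)
  case 0
  then show ?case
    using Ck_continuous[of "Suc 0" f] by simp
qed auto

lemma Ck_const: "Ck k (\<lambda>x. c)"
  by (induction k arbitrary: c)
    (simp, rule Ck_SucI[where D = "\<lambda>_ _. 0"], auto)

lemma Ck_coord:
  fixes i :: "'d::finite"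
  shows "Ck k (\<lambda>x. x $ i)"
proof (cases k)
  case 0
  then show ?thesis by (simp add: continuous_on_component)
next
  case (Suc m)
  have "((\<lambda>x. x $ i) has_derivative (\<lambda>h. h $ i)) (at x)" for x :: "real^'d"
    by (rule bounded_linear_imp_has_derivative) (rule bounded_linear_vec_nth)
  then show ?thesis
    unfolding Suc by (rule Ck_SucI) (rule Ck_const)
qed

lemma Ck_add: "Ck k f \<Longrightarrow> Ck k g \<Longrightarrow> Ck k (\<lambda>x. f x + g x)"
proof (induction k arbitrary: f g)
  case 0
  then show ?case by (simp add: continuous_on_add)
next
  case (Suc k)
  show ?case
  proof (rule Ck_SucI)
    show "((\<lambda>x. f x + g x) has_derivative
      (\<lambda>h. frechet_derivative f (at x) h + frechet_derivative g (at x) h)) (at x)" for x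
      by (intro has_derivative_add Ck_Suc_has_derivative[OF Suc.prems(1)]
          Ck_Suc_has_derivative[OF Suc.prems(2)])
    show "Ck k (\<lambda>x. frechet_derivative f (at x) (axis i 1) + frechet_derivative g (at x) (axis i 1))" for i
      using Suc.prems by (intro Suc.IH) (simp_all add: partial_deriv_def[abs_def])
  qed
qed

lemma Ck_mult: "Ck k f \<Longrightarrow> Ck k g \<Longrightarrow> Ck k (\<lambda>x. f x * g x)"
proof (induction k arbitrary: f g)
  case 0
  then show ?case by (simp add: continuous_on_mult)
next
  case (Suc k)
  show ?case
  proof (rule Ck_SucI)
    show "((\<lambda>x. f x * g x) has_derivative
      (\<lambda>h. f x * frechet_derivative g (at x) h + frechet_derivative f (at x) h * g x)) (at x)" for x
      by (intro has_derivative_mult Ck_Suc_has_derivative[OF Suc.prems(1)]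
          Ck_Suc_has_derivative[OF Suc.prems(2)])
    show "Ck k (\<lambda>x. f x * frechet_derivative g (at x) (axis i 1) +
        frechet_derivative f (at x) (axis i 1) * g x)" for i
      using Suc.prems Ck_Suc_imp[of k f] Ck_Suc_imp[of k g]
      by (intro Ck_add Suc.IH) (simp_all add: partial_deriv_def[abs_def])
  qed
qed

lemma Ck_prod: "finite I \<Longrightarrow> (\<And>i. i \<in> I \<Longrightarrow> Ck k (f i)) \<Longrightarrow> Ck k (\<lambda>x. \<Prod>i\<in>I. f i x)"
  by (induction I rule: finite_induct) (auto intro: Ck_const Ck_mult)

text \<open>For \<open>j = 0\<close> this is the standard smooth function vanishing on the negative half line. The factor
\<open>1 / t\<^sup>j\<close> makes the family closed under differentiation up to linear combinations, so that
smoothness of all members follows by a single induction.\<close>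

definition exp_cutoff :: "nat \<Rightarrow> real \<Rightarrow> real" where
  "exp_cutoff j t = (if 0 < t then inverse t ^ j * exp (- inverse t) else 0)"

lemma exp_cutoff_tendsto_0: "(exp_cutoff j \<longlongrightarrow> 0) (at 0)"
proof (rule filterlim_split_at)
  show "(exp_cutoff j \<longlongrightarrow> 0) (at_left 0)"
    by (rule tendsto_eventually) (auto simp: exp_cutoff_def eventually_at_left_field intro!: exI[of _ "-1"])
  have "((\<lambda>t. (inverse t) ^ j / exp (inverse t :: real)) \<longlongrightarrow> 0) (at_right 0)"
    by (rule filterlim_compose[OF tendsto_power_div_exp_0 filterlim_inverse_at_top_right])
  then show "(exp_cutoff j \<longlongrightarrow> 0) (at_right 0)"
    by (rule Lim_transform_eventually)
      (auto simp: exp_cutoff_def eventually_at_right_field exp_minus divide_inverse intro!: exI[of _ 1])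
qed

lemma exp_cutoff_has_derivative:
  "(exp_cutoff j has_real_derivative exp_cutoff (j + 2) t - real j * exp_cutoff (j + 1) t) (at t)"
proof -
  consider "t < 0" | "t = 0" | "t > 0" by linarith
  then show ?thesis
  proof cases
    case 1
    have "(exp_cutoff j has_real_derivative 0) (at t)"
      by (rule has_field_derivative_transform_within_open[where f = "\<lambda>_. 0" and S = "{..<0}"])
        (use 1 in \<open>auto simp: exp_cutoff_def\<close>)
    with 1 show ?thesis by (simp add: exp_cutoff_def)
  next
    case 2
    have "(\<lambda>h. exp_cutoff j h / h) = exp_cutoff (j + 1)"
      by (auto simp: exp_cutoff_def divide_inverse)
    then have "(exp_cutoff j has_real_derivative 0) (at 0)"
      using exp_cutoff_tendsto_0[of "j + 1"]
      by (simp add: DERIV_def) (simp add: exp_cutoff_def)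
    with 2 show ?thesis by (simp add: exp_cutoff_def)
  next
    case 3
    define y where "y = inverse t"
    have cutoff_y: "exp_cutoff m t = y ^ m * exp (- y)" for m
      using 3 by (simp add: exp_cutoff_def y_def)
    have "((\<lambda>y. y ^ j * exp (- y)) has_real_derivative (real j * y ^ (j - 1) - y ^ j) * exp (- y)) (at y)"
      by (auto intro!: derivative_eq_intros simp: algebra_simps)
    moreover have "(inverse has_real_derivative - (y * y)) (at t)"
      using 3 DERIV_inverse[of t] by (simp add: y_def power2_eq_square)
    ultimately have deriv: "((\<lambda>t. inverse t ^ j * exp (- inverse t)) has_real_derivative
        (real j * y ^ (j - 1) - y ^ j) * exp (- y) * - (y * y)) (at t)"
      unfolding y_def by (rule DERIV_chain2)
    have eq: "(real j * y ^ (j - 1) - y ^ j) * exp (- y) * - (y * y) =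
        exp_cutoff (j + 2) t - real j * exp_cutoff (j + 1) t"
      unfolding cutoff_y by (cases j) (simp_all add: algebra_simps)
    show ?thesis
      by (rule has_field_derivative_transform_within_open[OF deriv[unfolded eq], of "{0<..}"])
        (use 3 in \<open>auto simp: exp_cutoff_def\<close>)
  qed
qed

text \<open>Each partial derivative is a combination of two other members of the family, which is why the
induction must leave \<open>j\<close> free.\<close>

lemma Ck_exp_cutoff:
  fixes i :: "'d::finite"
  shows "Ck k (\<lambda>x. exp_cutoff j (c * x $ i + d))"
proof (induction k arbitrary: j)
  case 0
  have "continuous_on UNIV (exp_cutoff j)"
    by (rule DERIV_continuous_on) (rule has_field_derivative_at_within, rule exp_cutoff_has_derivative)
  then have "continuous_on UNIV (\<lambda>x. exp_cutoff j (c * x $ i + d))"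
    by (rule continuous_on_compose2) (auto intro!: continuous_intros)
  then show ?case by simp
next
  case (Suc k)
  let ?D = "\<lambda>x. exp_cutoff (j + 2) (c * x $ i + d) + (- real j) * exp_cutoff (j + 1) (c * x $ i + d)"
  show ?case
  proof (rule Ck_SucI)
    fix x :: "real^'d"
    have "((\<lambda>x. c * x $ i + d) has_derivative (\<lambda>h. c * h $ i)) (at x)"
      by (auto intro!: derivative_eq_intros bounded_linear_imp_has_derivative bounded_linear_vec_nth)
    from has_derivative_compose[OF this
        exp_cutoff_has_derivative[of j, unfolded has_field_derivative_def]]
    show "((\<lambda>x. exp_cutoff j (c * x $ i + d)) has_derivative (\<lambda>h. ?D x * (c * h $ i))) (at x)"
      by (simp add: algebra_simps)
  next
    show "Ck k (\<lambda>x. ?D x * (c * axis i' 1 $ i))" for i'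
      by (intro Ck_mult Ck_add Ck_const Suc.IH)
  qed
qed

lemma exp_cutoff_0_bounds: "0 \<le> exp_cutoff 0 t" "exp_cutoff 0 t \<le> 1"
  by (auto simp: exp_cutoff_def)

lemma exp_cutoff_0_tendsto_1:
  assumes "0 < s"
  shows "(\<lambda>n. exp_cutoff 0 (real n * s - 1)) \<longlonglongrightarrow> 1"
proof -
  have "filterlim (\<lambda>n. -1 + real n * s) at_top sequentially"
    by (intro filterlim_tendsto_add_at_top[OF tendsto_const]
        filterlim_at_top_mult_tendsto_pos[OF tendsto_const assms] filterlim_real_sequentially)
  then have lim: "filterlim (\<lambda>n. real n * s - 1) at_top sequentially"
    by (simp add: algebra_simps)
  have "(\<lambda>n. exp (- inverse (real n * s - 1))) \<longlonglongrightarrow> exp (- 0)"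
    by (intro tendsto_intros tendsto_inverse_0_at_top[OF lim])
  moreover have "\<forall>\<^sub>F n in sequentially. 0 < real n * s - 1"
    using lim unfolding filterlim_at_top_dense by blast
  then have "\<forall>\<^sub>F n in sequentially.
      exp (- inverse (real n * s - 1)) = exp_cutoff 0 (real n * s - 1)"
    by eventually_elim (simp add: exp_cutoff_def)
  ultimately have "(\<lambda>n. exp_cutoff 0 (real n * s - 1)) \<longlonglongrightarrow> exp (- 0)"
    by (rule Lim_transform_eventually)
  then show ?thesis by simp
qed

text \<open>The shifts by 1 keep the support of the cut-off at distance \<open>1 / n\<close> from the boundary of the box; the
support is therefore a compact subset of the open box, and these functions are admissible test
functions even for boxes that touch the boundary of the domain.\<close>

definition box_cutoff :: "real^'d \<Rightarrow> real^'d \<Rightarrow> nat \<Rightarrow> real^'d \<Rightarrow> real" where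
  "box_cutoff a b n x =
     (\<Prod>i\<in>UNIV. exp_cutoff 0 (real n * (x $ i - a $ i) - 1) * exp_cutoff 0 (real n * (b $ i - x $ i) - 1))"

lemma box_cutoff_bounds: "0 \<le> box_cutoff a b n x" "box_cutoff a b n x \<le> 1"
  unfolding box_cutoff_def
  by (auto intro!: prod_nonneg prod_le_1 mult_nonneg_nonneg mult_le_one exp_cutoff_0_bounds)

lemma box_cutoff_eq_0:
  assumes "\<not> (\<forall>i. 1 < real n * (x $ i - a $ i) \<and> 1 < real n * (b $ i - x $ i))"
  shows "box_cutoff a b n x = 0"
proof -
  obtain i where "\<not> (1 < real n * (x $ i - a $ i) \<and> 1 < real n * (b $ i - x $ i))"
    using assms by blast
  then show ?thesis
    unfolding box_cutoff_def
    by (intro prod_zero) (auto simp: exp_cutoff_def intro!: bexI[of _ i])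
qed

lemma box_cutoff_test_function:
  assumes "box a b \<subseteq> \<Omega>"
  shows "box_cutoff a b n \<in> test_functions \<Omega>"
proof -
  let ?S = "cbox (\<chi> i. a $ i + 1 / real n) (\<chi> i. b $ i - 1 / real n)"
  have "Ck k (box_cutoff a b n)" for k
  proof -
    have "box_cutoff a b n = (\<lambda>x. \<Prod>i\<in>UNIV.
        exp_cutoff 0 (real n * x $ i + (- real n * a $ i - 1)) *
        exp_cutoff 0 (- real n * x $ i + (real n * b $ i - 1)))"
      by (auto simp: box_cutoff_def algebra_simps)
    then show ?thesis
      by (simp only:) (intro Ck_prod Ck_mult Ck_exp_cutoff finite)
  qed
  moreover have "\<exists>S. compact S \<and> S \<subseteq> \<Omega> \<and> (\<forall>x. x \<notin> S \<longrightarrow> box_cutoff a b n x = 0)"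
  proof (cases "n = 0")
    case True
    then have "box_cutoff a b n x = 0" for x
      by (intro box_cutoff_eq_0) simp
    then show ?thesis
      by (intro exI[of _ "{}"]) simp
  next
    case False
    have n: "0 < 1 / real n"
      using False by simp
    have "x \<in> box a b" if "x \<in> ?S" for x
    proof -
      have x: "a $ i + 1 / real n \<le> x $ i" "x $ i \<le> b $ i - 1 / real n" for i
        using that by (simp_all add: mem_box_cart)
      have "a $ i < x $ i" "x $ i < b $ i" for i
        using x[of i] n by linarith+
      then show ?thesis
        by (simp add: mem_box_cart)
    qed
    then have "?S \<subseteq> box a b"
      by blast
    moreover have "box_cutoff a b n x = 0" if "x \<notin> ?S" for x
    proof (rule box_cutoff_eq_0, rule notI)
      assume *: "\<forall>i. 1 < real n * (x $ i - a $ i) \<and> 1 < real n * (b $ i - x $ i)"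
      have "1 / real n < x $ i - a $ i" "1 / real n < b $ i - x $ i" for i
        using *[rule_format, of i] False by (simp_all add: divide_less_eq mult.commute)
      then have "a $ i + 1 / real n \<le> x $ i" "x $ i \<le> b $ i - 1 / real n" for i
        by (simp_all add: less_imp_le algebra_simps)
      then show False
        using that by (simp add: mem_box_cart)
    qed
    ultimately show ?thesis
      using assms by (intro exI[of _ ?S]) auto
  qed
  ultimately show ?thesis
    by (simp add: test_functions_def)
qed

lemma box_cutoff_tendsto: "(\<lambda>n. box_cutoff a b n x) \<longlonglongrightarrow> indicator (box a b) x"
proof (cases "x \<in> box a b")
  case True
  have "(\<lambda>n. box_cutoff a b n x) \<longlonglongrightarrow> (\<Prod>i\<in>(UNIV::'a set). 1 * 1)"
    unfolding box_cutoff_def using True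
    by (intro tendsto_prod tendsto_mult exp_cutoff_0_tendsto_1) (auto simp: mem_box_cart)
  with True show ?thesis by simp
next
  case False
  then obtain i where "\<not> (a $ i < x $ i \<and> x $ i < b $ i)"
    by (auto simp: mem_box_cart)
  then have "real n * (x $ i - a $ i) \<le> 0 \<or> real n * (b $ i - x $ i) \<le> 0" for n
    by (auto simp: not_less mult_le_0_iff)
  then have "box_cutoff a b n x = 0" for n
    by (intro box_cutoff_eq_0) (smt (verit))
  with False show ?thesis by simp
qed

section \<open>The fundamental lemma of the calculus of variations\<close>

text \<open>Dominated convergence along the cut-offs shows that \<open>h\<close> has integral zero over every open box inside the domain. Within a fixed such box the boxes
form an intersection-stable generator of the Borel sets, so the integral over every Borel subset
vanishes and \<open>h\<close> is zero almost everywhere there. Countably many boxes exhaust the domain.\<close>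

lemma fundamental_lemma:
  fixes h :: "real^'d \<Rightarrow> real"
  assumes \<Omega>: "open \<Omega>"
    and h: "integrable (lebesgue_on \<Omega>) h"
    and zero: "\<And>\<psi>. \<psi> \<in> test_functions \<Omega> \<Longrightarrow> (LINT x|lebesgue_on \<Omega>. h x * \<psi> x) = 0"
  shows "AE x in lebesgue_on \<Omega>. h x = 0"
proof -
  have \<Omega>_sets: "\<Omega> \<inter> space lebesgue \<in> sets lebesgue"
    using \<Omega> by auto
  \<comment> \<open>Boxes generate only the Borel sets, hence the passage to a Borel representative \<open>g\<close>.\<close>
  let ?h = "\<lambda>x. indicator \<Omega> x * h x"
  have int_h: "integrable lebesgue ?h"
    using h \<Omega>_sets by (simp add: integrable_restrict_space)
  then have "?h \<in> borel_measurable lebesgue"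
    by (rule borel_measurable_integrable)
  then obtain g where g[measurable]: "g \<in> borel_measurable lborel" and ae: "AE x in lborel. ?h x = g x"
    using completion_ex_borel_measurable_real by blast
  have ae': "AE x in lebesgue. ?h x = g x"
    using ae by (rule AE_completion)
  have g': "g \<in> borel_measurable lebesgue"
    using g by (rule measurable_completion)
  have "integrable lebesgue g"
    using int_h ae' by (rule integrable_cong_AE_imp[OF _ g'])
  then have int_g: "integrable lborel g"
    using g by (simp add: integrable_completion)
  have g_test: "(LINT x|lborel. g x * \<psi> x) = 0" if \<psi>: "\<psi> \<in> test_functions \<Omega>" for \<psi>
  proof -
    have [measurable]: "\<psi> \<in> borel_measurable borel"
      using \<psi> by (auto simp: test_functions_def intro!: borel_measurable_continuous_onI Ck_continuous[of 0])
    have "(LINT x|lborel. g x * \<psi> x) = (LINT x|lebesgue. g x * \<psi> x)"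
      by (rule integral_completion[symmetric]) simp
    also have "\<dots> = (LINT x|lebesgue. ?h x * \<psi> x)"
    proof (rule integral_cong_AE)
      show "(\<lambda>x. g x * \<psi> x) \<in> borel_measurable lebesgue"
        by (rule measurable_completion) simp
      have "\<psi> \<in> borel_measurable lebesgue"
        by (rule measurable_completion) simp
      then show "(\<lambda>x. ?h x * \<psi> x) \<in> borel_measurable lebesgue"
        using borel_measurable_integrable[OF int_h] by simp
      show "AE x in lebesgue. g x * \<psi> x = ?h x * \<psi> x"
        using ae' by eventually_elim simp
    qed
    also have "\<dots> = (LINT x|lebesgue_on \<Omega>. h x * \<psi> x)"
      using \<Omega>_sets by (simp add: integral_restrict_space mult.assoc)
    finally show ?thesis
      using zero[OF \<psi>] by simp
  qed
  have g_box: "(LINT x:box a b|lborel. g x) = 0" if "box a b \<subseteq> \<Omega>" for a b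
  proof -
    have "(\<lambda>n. LINT x|lborel. g x * box_cutoff a b n x) \<longlonglongrightarrow> (LINT x|lborel. g x * indicator (box a b) x)"
    proof (rule integral_dominated_convergence)
      show "(\<lambda>x. g x * box_cutoff a b n x) \<in> borel_measurable lborel" for n
      proof -
        have [measurable]: "box_cutoff a b n \<in> borel_measurable borel"
          using box_cutoff_test_function[OF that, of n]
          by (auto simp: test_functions_def intro!: borel_measurable_continuous_onI Ck_continuous[of 0])
        show ?thesis by simp
      qed
      show "integrable lborel (\<lambda>x. norm (g x))"
        using int_g by simp
      show "AE x in lborel. (\<lambda>n. g x * box_cutoff a b n x) \<longlonglongrightarrow> g x * indicator (box a b) x"
        by (intro AE_I2 tendsto_mult tendsto_const box_cutoff_tendsto)
      show "AE x in lborel. norm (g x * box_cutoff a b n x) \<le> norm (g x)" for n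
        using box_cutoff_bounds[of a b n] by (intro AE_I2) (auto simp: abs_mult intro!: mult_left_le)
    qed simp
    then have "(\<lambda>n::nat. 0) \<longlonglongrightarrow> (LINT x|lborel. g x * indicator (box a b) x)"
      using g_test[OF box_cutoff_test_function[OF that]] by simp
    then show ?thesis
      by (simp add: LIMSEQ_const_iff set_lebesgue_integral_def mult.commute)
  qed
  have ae_box: "AE x in lborel. x \<in> C \<longrightarrow> g x = 0" if C: "C = box c d" "C \<subseteq> \<Omega>" for C c d
  proof -
    have [measurable]: "C \<in> sets borel"
      using C by simp
    have int_C: "set_integrable lborel A (\<lambda>x. indicator C x * g x)" if "A \<in> sets borel" for A
      using that int_g integrable_mult_indicator[of C lborel g]
        integrable_mult_indicator[of A lborel "\<lambda>x. indicator C x * g x"]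
      by (simp add: set_integrable_def)
    have "(LINT x:A|lborel. indicator C x * g x) = 0" if "A \<in> sets lborel" for A
    proof -
      have "Int_stable (range (\<lambda> (a, b). box a b :: (real^'d) set))"
        by (auto simp: Int_stable_def box_Int_box)
      moreover have "range (\<lambda> (a, b). box a b :: (real^'d) set) \<subseteq> Pow UNIV"
        by simp
      moreover have "A \<in> sigma_sets UNIV (range (\<lambda> (a, b). box a b))"
        using that by (simp add: borel_eq_box)
      ultimately show ?thesis
      proof (induction rule: sigma_sets_induct_disjoint)
        case (basic A)
        then obtain a b where A: "A = box a b" by auto
        obtain a' b' where eq: "box a b \<inter> C = box a' b'"
          using C(1) box_Int_box by blast
        have "(LINT x:A|lborel. indicator C x * g x) = (LINT x:box a' b'|lborel. g x)"
          unfolding set_lebesgue_integral_def A eq[symmetric]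
          by (intro Bochner_Integration.integral_cong) (auto simp: indicator_def)
        also have "\<dots> = 0"
          using eq C by (intro g_box) blast
        finally show ?case .
      next
        case empty
        then show ?case by (simp add: set_lebesgue_integral_def)
      next
        case (compl A)
        then have [measurable]: "A \<in> sets borel"
          by (simp add: borel_eq_box)
        have "(LINT x:A \<union> (UNIV - A)|lborel. indicator C x * g x) =
          (LINT x:A|lborel. indicator C x * g x) + (LINT x:UNIV - A|lborel. indicator C x * g x)"
          by (intro set_integral_Un int_C) auto
        moreover have "(LINT x:A \<union> (UNIV - A)|lborel. indicator C x * g x) = (LINT x:box c d|lborel. g x)"
          by (simp add: set_lebesgue_integral_def C)
        ultimately show ?case
          using compl g_box[of c d] C by simp
      next
        case (union F)
        have F: "F i \<in> sets borel" for i
          using union by (auto simp: borel_eq_box)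
        have "(LINT x:(\<Union>i. F i)|lborel. indicator C x * g x) = (\<Sum>i. (LINT x:F i|lborel. indicator C x * g x))"
          using F union(1)
          by (intro lebesgue_integral_countable_add int_C) (auto simp: disjoint_family_on_def)
        then show ?case
          using union by simp
      qed
    qed
    moreover have "integrable lborel (\<lambda>x. indicator C x * g x)"
      using int_C[of UNIV] by (simp add: set_integrable_def)
    ultimately have "AE x in lborel. indicator C x * g x = 0"
      by (intro density_unique_real) (auto simp: set_lebesgue_integral_def)
    then show ?thesis
      by eventually_elim auto
  qed
  obtain \<D> where \<D>: "countable \<D>" "\<D> \<subseteq> Pow \<Omega>" "\<And>X. X \<in> \<D> \<Longrightarrow> \<exists>a b. X = box a b" "\<Union>\<D> = \<Omega>"
    using open_countable_Union_open_box[OF \<Omega>] by metis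
  have "AE x in lborel. x \<in> C \<longrightarrow> g x = 0" if C: "C \<in> \<D>" for C
  proof -
    obtain a b where "C = box a b"
      using \<D>(3)[OF C] by blast
    then show ?thesis
      by (rule ae_box) (use \<D>(2) C in auto)
  qed
  then have "AE x in lborel. \<forall>C\<in>\<D>. x \<in> C \<longrightarrow> g x = 0"
    by (subst AE_ball_countable[OF \<D>(1)]) blast
  then have "AE x in lborel. x \<in> \<Omega> \<longrightarrow> h x = 0"
    using ae
  proof eventually_elim
    case (elim x)
    show ?case
    proof
      assume x: "x \<in> \<Omega>"
      then have "g x = 0"
        using elim(1) \<D>(4) by blast
      then show "h x = 0"
        using elim(2) x by simp
    qed
  qed
  then show ?thesis
    using \<Omega>_sets by (simp add: AE_restrict_space_iff AE_completion)
qed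

section \<open>Square integrable functions\<close>

locale bounded_open_set =
  fixes \<Omega> :: "(real^'d) set"
  assumes open_set: "open \<Omega>" and bounded_set: "bounded \<Omega>"
begin

lemma sets_\<Omega> [simp]: "\<Omega> \<in> sets lebesgue"
  using open_set by auto

sublocale finite_measure "lebesgue_on \<Omega>"
  using bounded_set by (intro finite_measure_lebesgue_on bounded_set_imp_lmeasurable) auto

lemma L2_measurable [measurable_dest]: "f \<in> L2 \<Omega> \<Longrightarrow> f \<in> borel_measurable (lebesgue_on \<Omega>)"
  by (simp add: L2_def)

lemma L2_square_integrable: "f \<in> L2 \<Omega> \<Longrightarrow> integrable (lebesgue_on \<Omega>) (\<lambda>x. (norm (f x))\<^sup>2)"
  by (simp add: L2_def)

lemma L2_bound:
  assumes "f \<in> borel_measurable (lebesgue_on \<Omega>)" "integrable (lebesgue_on \<Omega>) h"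
    and "AE x in lebesgue_on \<Omega>. (norm (f x))\<^sup>2 \<le> h x"
  shows "f \<in> L2 \<Omega>"
proof -
  have "integrable (lebesgue_on \<Omega>) (\<lambda>x. (norm (f x))\<^sup>2)"
    by (rule Bochner_Integration.integrable_bound[OF assms(2)]) (use assms in auto)
  with assms show ?thesis
    by (simp add: L2_def)
qed

text \<open>Products of two square integrable functions are dominated through \<open>a b \<le> a\<^sup>2 + b\<^sup>2\<close>, which is
enough for integrability.\<close>

lemma L2_product_bound:
  fixes f :: "real^'d \<Rightarrow> 'b::euclidean_space" and g :: "real^'d \<Rightarrow> 'c::euclidean_space"
    and h :: "real^'d \<Rightarrow> real"
  assumes fg: "f \<in> L2 \<Omega>" "g \<in> L2 \<Omega>" and h: "h \<in> borel_measurable (lebesgue_on \<Omega>)"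
    and bound: "AE x in lebesgue_on \<Omega>. \<bar>h x\<bar> \<le> C * (norm (f x) * norm (g x))"
  shows "integrable (lebesgue_on \<Omega>) h"
proof (rule Bochner_Integration.integrable_bound[OF _ h])
  show "integrable (lebesgue_on \<Omega>) (\<lambda>x. \<bar>C\<bar> * ((norm (f x))\<^sup>2 + (norm (g x))\<^sup>2))"
    using fg by (intro integrable_mult_right Bochner_Integration.integrable_add L2_square_integrable)
  have "C * (norm (f x) * norm (g x)) \<le> \<bar>C\<bar> * ((norm (f x))\<^sup>2 + (norm (g x))\<^sup>2)" for x
  proof -
    have "norm (f x) * norm (g x) \<le> (norm (f x))\<^sup>2 + (norm (g x))\<^sup>2"
      using sum_squares_bound[of "norm (f x)" "norm (g x)"] mult_nonneg_nonneg[OF norm_ge_zero norm_ge_zero, of "f x" "g x"]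
      by linarith
    then show ?thesis
      by (intro mult_mono) auto
  qed
  with bound show "AE x in lebesgue_on \<Omega>. norm (h x) \<le> norm (\<bar>C\<bar> * ((norm (f x))\<^sup>2 + (norm (g x))\<^sup>2))"
    by (auto elim!: eventually_mono order_trans)
qed

lemma L2_mult_integrable:
  fixes f g :: "real^'d \<Rightarrow> real"
  assumes [measurable]: "f \<in> L2 \<Omega>" "g \<in> L2 \<Omega>"
  shows "integrable (lebesgue_on \<Omega>) (\<lambda>x. f x * g x)"
  by (rule L2_product_bound[OF assms, where C = 1]) (auto simp: abs_mult)

lemma L2_add:
  assumes [measurable]: "f \<in> L2 \<Omega>" "g \<in> L2 \<Omega>"
  shows "(\<lambda>x. f x + g x) \<in> L2 \<Omega>"
proof (rule L2_bound)
  show "integrable (lebesgue_on \<Omega>) (\<lambda>x. 2 * (norm (f x))\<^sup>2 + 2 * (norm (g x))\<^sup>2)"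
    using assms by (intro integrable_mult_right Bochner_Integration.integrable_add L2_square_integrable)
  have "(norm (f x + g x))\<^sup>2 \<le> 2 * (norm (f x))\<^sup>2 + 2 * (norm (g x))\<^sup>2" for x
  proof -
    have "(norm (f x + g x))\<^sup>2 \<le> (norm (f x) + norm (g x))\<^sup>2"
      by (intro power_mono norm_triangle_ineq) auto
    then show ?thesis
      using sum_squares_bound[of "norm (f x)" "norm (g x)"] by (simp add: power2_sum)
  qed
  then show "AE x in lebesgue_on \<Omega>. (norm (f x + g x))\<^sup>2 \<le> 2 * (norm (f x))\<^sup>2 + 2 * (norm (g x))\<^sup>2"
    by simp
qed simp

lemma L2_scaleR:
  assumes [measurable]: "f \<in> L2 \<Omega>"
  shows "(\<lambda>x. c *\<^sub>R f x) \<in> L2 \<Omega>"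
  by (rule L2_bound[OF _ integrable_mult_right[OF L2_square_integrable[OF assms], of "c\<^sup>2"]])
    (auto simp: power_mult_distrib)

lemma L2_zero: "(\<lambda>x. 0) \<in> L2 \<Omega>"
  by (simp add: L2_def)

lemma L2_sum:
  "finite I \<Longrightarrow> (\<And>i. i \<in> I \<Longrightarrow> f i \<in> L2 \<Omega>) \<Longrightarrow> (\<lambda>x. \<Sum>i\<in>I. f i x) \<in> L2 \<Omega>"
  by (induction I rule: finite_induct) (auto intro: L2_zero L2_add)

lemma L2_diff: "f \<in> L2 \<Omega> \<Longrightarrow> g \<in> L2 \<Omega> \<Longrightarrow> (\<lambda>x. f x - g x) \<in> L2 \<Omega>"
  using L2_add[of f "\<lambda>x. (-1) *\<^sub>R g x"] L2_scaleR[of g "-1"] by simp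

lemma L2_component:
  fixes g :: "real^'d \<Rightarrow> real^'n"
  assumes g: "g \<in> L2 \<Omega>"
  shows "(\<lambda>x. g x $ i) \<in> L2 \<Omega>"
proof (rule L2_bound[OF _ L2_square_integrable[OF g]])
  have "(\<lambda>y :: real^'n. y $ i) \<in> borel_measurable borel"
    by (intro borel_measurable_continuous_onI continuous_intros)
  then show "(\<lambda>x. g x $ i) \<in> borel_measurable (lebesgue_on \<Omega>)"
    by (rule measurable_compose[OF L2_measurable[OF g]])
  show "AE x in lebesgue_on \<Omega>. (norm (g x $ i))\<^sup>2 \<le> (norm (g x))\<^sup>2"
    by (intro AE_I2 power_mono) (auto simp: component_le_norm_cart)
qed

lemma L2_continuous:
  fixes f :: "real^'d \<Rightarrow> 'b::euclidean_space"
  assumes "continuous_on UNIV f"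
  shows "f \<in> L2 \<Omega>"
proof -
  have "compact (f ` closure \<Omega>)"
    using assms bounded_set by (intro compact_continuous_image) (auto intro: continuous_on_subset)
  then obtain C where "\<forall>x\<in>closure \<Omega>. norm (f x) \<le> C"
    by (auto dest!: compact_imp_bounded simp: bounded_iff)
  then have C: "norm (f x) \<le> C" if "x \<in> \<Omega>" for x
    using that closure_subset[of \<Omega>] by blast
  show ?thesis
  proof (rule L2_bound)
    have "f \<in> borel_measurable lebesgue"
      using assms by (intro measurable_completion) (simp add: borel_measurable_continuous_onI)
    then show "f \<in> borel_measurable (lebesgue_on \<Omega>)"
      by (rule measurable_restrict_space1)
    show "integrable (lebesgue_on \<Omega>) (\<lambda>x. C\<^sup>2)"
      by simp
    show "AE x in lebesgue_on \<Omega>. (norm (f x))\<^sup>2 \<le> C\<^sup>2"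
      using C by (intro AE_I2 power_mono) auto
  qed
qed

lemma test_function_L2: "\<psi> \<in> test_functions \<Omega> \<Longrightarrow> \<psi> \<in> L2 \<Omega>"
  by (rule L2_continuous) (auto simp: test_functions_def intro: Ck_continuous[of 0])

lemma test_function_partial_deriv_L2: "\<psi> \<in> test_functions \<Omega> \<Longrightarrow> partial_deriv i \<psi> \<in> L2 \<Omega>"
  by (rule L2_continuous, rule Ck_continuous[of 0]) (auto simp: test_functions_def dest: spec[of _ "Suc 0"])

section \<open>Uniqueness and linearity of the weak gradient\<close>

lemma weak_grad_of_H1:
  assumes "v \<in> H1 \<Omega>"
  shows "weak_grad \<Omega> v \<in> L2 \<Omega>" "has_weak_grad \<Omega> v (weak_grad \<Omega> v)"
proof -
  have "\<exists>g. g \<in> L2 \<Omega> \<and> has_weak_grad \<Omega> v g"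
    using assms by (auto simp: H1_def)
  from someI_ex[OF this] show "weak_grad \<Omega> v \<in> L2 \<Omega>" "has_weak_grad \<Omega> v (weak_grad \<Omega> v)"
    by (simp_all add: weak_grad_def)
qed

lemma H1_L2: "v \<in> H1 \<Omega> \<Longrightarrow> v \<in> L2 \<Omega>"
  by (simp add: H1_def)

lemma weak_grad_unique:
  assumes "g \<in> L2 \<Omega>" "h \<in> L2 \<Omega>" "has_weak_grad \<Omega> v g" "has_weak_grad \<Omega> v h"
  shows "AE x in lebesgue_on \<Omega>. g x = h x"
proof -
  have "AE x in lebesgue_on \<Omega>. g x $ i - h x $ i = 0" for i
  proof (rule fundamental_lemma[OF open_set])
    have L2: "(\<lambda>x. g x $ i - h x $ i) \<in> L2 \<Omega>"
      using assms by (intro L2_diff L2_component)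
    show "integrable (lebesgue_on \<Omega>) (\<lambda>x. g x $ i - h x $ i)"
      using L2_mult_integrable[OF L2 L2_continuous[of "\<lambda>_. 1"]] by simp
    fix \<psi> assume \<psi>: "\<psi> \<in> test_functions \<Omega>"
    have "(LINT x|lebesgue_on \<Omega>. (g x $ i - h x $ i) * \<psi> x) =
      (LINT x|lebesgue_on \<Omega>. g x $ i * \<psi> x) - (LINT x|lebesgue_on \<Omega>. h x $ i * \<psi> x)"
      unfolding left_diff_distrib
      by (intro Bochner_Integration.integral_diff L2_mult_integrable L2_component assms test_function_L2 \<psi>)
    also have "\<dots> = 0"
    proof -
      have "(LINT x|lebesgue_on \<Omega>. v x * partial_deriv i \<psi> x) = - (LINT x|lebesgue_on \<Omega>. g x $ i * \<psi> x)"
        using assms(3) \<psi> by (simp add: has_weak_grad_def)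
      moreover have "(LINT x|lebesgue_on \<Omega>. v x * partial_deriv i \<psi> x) = - (LINT x|lebesgue_on \<Omega>. h x $ i * \<psi> x)"
        using assms(4) \<psi> by (simp add: has_weak_grad_def)
      ultimately show ?thesis by linarith
    qed
    finally show "(LINT x|lebesgue_on \<Omega>. (g x $ i - h x $ i) * \<psi> x) = 0" .
  qed
  then have "AE x in lebesgue_on \<Omega>. \<forall>i. g x $ i - h x $ i = 0"
    by (simp add: AE_all_countable)
  then show ?thesis
    by (auto simp: Finite_Cartesian_Product.vec_eq_iff)
qed

lemma has_weak_grad_sum:
  assumes I: "finite I" and v: "\<And>j. j \<in> I \<Longrightarrow> v j \<in> H1 \<Omega>"
  shows "has_weak_grad \<Omega> (\<lambda>x. \<Sum>j\<in>I. c j * v j x) (\<lambda>x. \<Sum>j\<in>I. c j *\<^sub>R weak_grad \<Omega> (v j) x)"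
  unfolding has_weak_grad_def
proof (intro ballI allI)
  fix \<psi> i assume \<psi>: "\<psi> \<in> test_functions \<Omega>"
  have "(LINT x|lebesgue_on \<Omega>. (\<Sum>j\<in>I. c j * v j x) * partial_deriv i \<psi> x) =
    (LINT x|lebesgue_on \<Omega>. (\<Sum>j\<in>I. c j * (v j x * partial_deriv i \<psi> x)))"
    by (simp add: sum_distrib_right mult.assoc)
  also have "\<dots> = (\<Sum>j\<in>I. c j * (LINT x|lebesgue_on \<Omega>. v j x * partial_deriv i \<psi> x))"
    using v \<psi> by (subst Bochner_Integration.integral_sum)
      (auto intro!: L2_mult_integrable H1_L2 test_function_partial_deriv_L2)
  also have "\<dots> = (\<Sum>j\<in>I. - (c j * (LINT x|lebesgue_on \<Omega>. weak_grad \<Omega> (v j) x $ i * \<psi> x)))"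
    using weak_grad_of_H1(2)[OF v] \<psi> by (intro sum.cong) (auto simp: has_weak_grad_def)
  also have "\<dots> = - (LINT x|lebesgue_on \<Omega>. (\<Sum>j\<in>I. c j * (weak_grad \<Omega> (v j) x $ i * \<psi> x)))"
    using v \<psi> by (subst Bochner_Integration.integral_sum)
      (auto intro!: L2_mult_integrable[OF L2_component[OF weak_grad_of_H1(1)] test_function_L2]
        simp: sum_negf)
  also have "\<dots> = - (LINT x|lebesgue_on \<Omega>. (\<Sum>j\<in>I. c j *\<^sub>R weak_grad \<Omega> (v j) x) $ i * \<psi> x)"
    by (simp add: sum_distrib_right mult.assoc)
  finally show "(LINT x|lebesgue_on \<Omega>. (\<Sum>j\<in>I. c j * v j x) * partial_deriv i \<psi> x) =
    - (LINT x|lebesgue_on \<Omega>. (\<Sum>j\<in>I. c j *\<^sub>R weak_grad \<Omega> (v j) x) $ i * \<psi> x)" .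
qed

lemma has_weak_grad_cong_AE:
  assumes [measurable]: "v \<in> L2 \<Omega>" "w \<in> L2 \<Omega>" and "AE x in lebesgue_on \<Omega>. v x = w x"
    and "has_weak_grad \<Omega> w g"
  shows "has_weak_grad \<Omega> v g"
  unfolding has_weak_grad_def
proof (intro ballI allI)
  fix \<psi> i assume \<psi>: "\<psi> \<in> test_functions \<Omega>"
  note [measurable] = test_function_partial_deriv_L2[OF \<psi>]
  have "(LINT x|lebesgue_on \<Omega>. v x * partial_deriv i \<psi> x) = (LINT x|lebesgue_on \<Omega>. w x * partial_deriv i \<psi> x)"
    using assms(3) by (intro integral_cong_AE) auto
  then show "(LINT x|lebesgue_on \<Omega>. v x * partial_deriv i \<psi> x) = - (LINT x|lebesgue_on \<Omega>. g x $ i * \<psi> x)"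
    using assms(4) \<psi> by (simp add: has_weak_grad_def)
qed

text \<open>The weak gradient is an arbitrary choice among its representatives, so its linearity is
uniqueness in disguise: the combination of the weak gradients is one weak gradient of the combination.\<close>

lemma weak_grad_lin_comb:
  assumes v: "v \<in> H1 \<Omega>" "AE x in lebesgue_on \<Omega>. v x = lin_comb \<phi> c x"
    and \<phi>: "\<And>j. j < dim_vec c \<Longrightarrow> \<phi> j \<in> H1 \<Omega>"
  shows "AE x in lebesgue_on \<Omega>. weak_grad \<Omega> v x = (\<Sum>j<dim_vec c. vec_index c j *\<^sub>R weak_grad \<Omega> (\<phi> j) x)"
proof (rule weak_grad_unique)
  show "(\<lambda>x. \<Sum>j<dim_vec c. vec_index c j *\<^sub>R weak_grad \<Omega> (\<phi> j) x) \<in> L2 \<Omega>"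
    using \<phi> by (intro L2_sum L2_scaleR weak_grad_of_H1) auto
  have "(\<lambda>x. \<Sum>j<dim_vec c. vec_index c j *\<^sub>R \<phi> j x) \<in> L2 \<Omega>"
    using \<phi> by (intro L2_sum L2_scaleR H1_L2) auto
  then have "lin_comb \<phi> c \<in> L2 \<Omega>"
    by (simp add: lin_comb_def[abs_def])
  moreover have "has_weak_grad \<Omega> (lin_comb \<phi> c) (\<lambda>x. \<Sum>j<dim_vec c. vec_index c j *\<^sub>R weak_grad \<Omega> (\<phi> j) x)"
    unfolding lin_comb_def[abs_def] using \<phi> by (intro has_weak_grad_sum) auto
  ultimately show "has_weak_grad \<Omega> v (\<lambda>x. \<Sum>j<dim_vec c. vec_index c j *\<^sub>R weak_grad \<Omega> (\<phi> j) x)"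
    using v H1_L2 has_weak_grad_cong_AE by blast
qed (use v weak_grad_of_H1 in auto)

text \<open>This replaces the Friedrichs inequality. Let \<open>\<psi>\<close> be a test function close to \<open>v\<close>. Testing the weak
gradient of \<open>v\<close> with \<open>x\<^sub>i \<psi>\<close> gives \<open>0 = \<integral> v \<psi> + \<integral> v x\<^sub>i \<partial>\<^sub>i\<psi>\<close>. As \<open>\<psi>\<close> tends to \<open>v\<close> and
\<open>\<partial>\<^sub>i\<psi>\<close> to zero, with \<open>x\<^sub>i\<close> bounded on the domain, the right-hand side tends to \<open>\<integral> v\<^sup>2\<close>.\<close>

lemma H10_weak_grad_zero:
  assumes v: "v \<in> H10 \<Omega>" and grad0: "AE x in lebesgue_on \<Omega>. weak_grad \<Omega> v x = 0"
  shows "AE x in lebesgue_on \<Omega>. v x = 0"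
proof -
  let ?M = "lebesgue_on \<Omega>"
  let ?G = "weak_grad \<Omega> v"
  obtain i :: 'd where True by blast
  have v1: "v \<in> H1 \<Omega>"
    using v by (simp add: H10_def)
  have v2: "v \<in> L2 \<Omega>"
    using v1 by (rule H1_L2)
  obtain R where R: "\<And>x. x \<in> \<Omega> \<Longrightarrow> \<bar>x $ i\<bar> \<le> R" "0 \<le> R"
  proof -
    obtain R where "\<And>x. x \<in> \<Omega> \<Longrightarrow> norm x \<le> R" "0 < R"
      using bounded_set by (auto simp: bounded_pos)
    then show ?thesis
      by (intro that[of R]) (use component_le_norm_cart in \<open>auto intro: order_trans\<close>)
  qed
  define I where "I = (LINT x|?M. (v x)\<^sup>2)"
  have int_v: "integrable ?M (\<lambda>x. (v x)\<^sup>2)"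
    using L2_square_integrable[OF v2] by simp
  have bound: "I \<le> 2 * (1 + R\<^sup>2) * \<epsilon>\<^sup>2" if \<epsilon>: "0 < \<epsilon>" for \<epsilon>
  proof -
    obtain \<psi> where \<psi>: "\<psi> \<in> test_functions \<Omega>" and less:
      "sqrt ((LINT x|?M. (v x - \<psi> x)\<^sup>2) + (LINT x|?M. (norm (?G x - gradient \<psi> x))\<^sup>2)) < \<epsilon>"
      using v \<epsilon> by (auto simp: H10_def)
    define \<eta> where "\<eta> = (\<lambda>x. x $ i * \<psi> x)"
    have \<eta>: "\<eta> \<in> test_functions \<Omega>"
      using \<psi> by (auto simp: test_functions_def \<eta>_def intro!: Ck_mult Ck_coord)
    have deriv_\<eta>: "partial_deriv i \<eta> x = \<psi> x + x $ i * partial_deriv i \<psi> x" for x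
    proof -
      have "(\<psi> has_derivative frechet_derivative \<psi> (at x)) (at x)"
        using \<psi> by (intro Ck_Suc_has_derivative[of 0]) (auto simp only: test_functions_def)
      then have "(\<eta> has_derivative (\<lambda>h. x $ i * frechet_derivative \<psi> (at x) h + h $ i * \<psi> x)) (at x)"
        unfolding \<eta>_def
        by (intro has_derivative_mult bounded_linear_imp_has_derivative bounded_linear_vec_nth)
      from partial_deriv_eq[OF this] show ?thesis
        by (simp add: partial_deriv_def)
    qed
    have "(LINT x|?M. v x * partial_deriv i \<eta> x) = - (LINT x|?M. ?G x $ i * \<eta> x)"
      using weak_grad_of_H1(2)[OF v1] \<eta> by (simp add: has_weak_grad_def)
    also have "(LINT x|?M. ?G x $ i * \<eta> x) = 0"
      using grad0 by (intro integral_eq_zero_AE) auto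
    finally have v\<eta>: "(LINT x|?M. v x * partial_deriv i \<eta> x) = 0"
      by simp
    have int_v\<eta>: "integrable ?M (\<lambda>x. v x * partial_deriv i \<eta> x)"
      by (intro L2_mult_integrable v2 test_function_partial_deriv_L2 \<eta>)
    have int_diff: "integrable ?M (\<lambda>x. (v x - \<psi> x)\<^sup>2)"
      using L2_square_integrable[OF L2_diff[OF v2 test_function_L2[OF \<psi>]]] by simp
    have "gradient \<psi> \<in> L2 \<Omega>"
    proof -
      have "gradient \<psi> = (\<lambda>x. \<Sum>j\<in>UNIV. partial_deriv j \<psi> x *\<^sub>R axis j 1)"
        by (rule ext) (simp add: gradient_def Finite_Cartesian_Product.vec_eq_iff axis_def if_distrib sum.delta sum.delta' cong: if_cong)
      moreover have "(\<lambda>x. partial_deriv j \<psi> x *\<^sub>R (axis j 1 :: real^'d)) \<in> L2 \<Omega>" for j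
        using test_function_partial_deriv_L2[OF \<psi>, of j]
        by (auto simp: L2_def intro!: borel_measurable_scaleR)
      ultimately show ?thesis
        by (simp add: L2_sum)
    qed
    then have int_grad: "integrable ?M (\<lambda>x. (norm (?G x - gradient \<psi> x))\<^sup>2)"
      by (intro L2_square_integrable L2_diff weak_grad_of_H1 v1)
    \<comment> \<open>Young's inequality applied to the two error terms leaves half of \<open>v\<^sup>2\<close> to be absorbed on the left.\<close>
    have "AE x in ?M. (v x)\<^sup>2 \<le>
      (1/2) * (v x)\<^sup>2 + (v x - \<psi> x)\<^sup>2 + R\<^sup>2 * (norm (?G x - gradient \<psi> x))\<^sup>2 + v x * partial_deriv i \<eta> x"
      using grad0
    proof (rule AE_mp, intro AE_I2 impI)
      fix x assume x: "x \<in> space ?M" and G0: "?G x = 0"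
      define a where "a = v x - \<psi> x"
      define b where "b = x $ i * partial_deriv i \<psi> x"
      have "\<bar>partial_deriv i \<psi> x\<bar> \<le> norm (?G x - gradient \<psi> x)"
        using component_le_norm_cart[of "gradient \<psi> x" i] G0 by (simp add: gradient_def)
      then have "\<bar>b\<bar> \<le> R * norm (?G x - gradient \<psi> x)"
        using R x unfolding b_def abs_mult by (intro mult_mono) auto
      then have "b\<^sup>2 \<le> R\<^sup>2 * (norm (?G x - gradient \<psi> x))\<^sup>2"
        using R(2) by (metis abs_le_square_iff abs_mult abs_norm_cancel abs_of_nonneg power_mult_distrib)
      moreover have "(v x)\<^sup>2 = v x * a - v x * b + v x * partial_deriv i \<eta> x"
        by (simp add: a_def b_def deriv_\<eta> algebra_simps power2_eq_square)
      moreover have "v x * a \<le> (1/4) * (v x)\<^sup>2 + a\<^sup>2"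
        using zero_le_power2[of "v x / 2 - a"] by (simp add: power2_eq_square algebra_simps)
      moreover have "- (v x * b) \<le> (1/4) * (v x)\<^sup>2 + b\<^sup>2"
        using zero_le_power2[of "v x / 2 + b"] by (simp add: power2_eq_square algebra_simps)
      ultimately show "(v x)\<^sup>2 \<le> (1/2) * (v x)\<^sup>2 + (v x - \<psi> x)\<^sup>2 +
          R\<^sup>2 * (norm (?G x - gradient \<psi> x))\<^sup>2 + v x * partial_deriv i \<eta> x"
        unfolding a_def by linarith
    qed
    then have "I \<le> (LINT x|?M. (1/2) * (v x)\<^sup>2 + (v x - \<psi> x)\<^sup>2 +
        R\<^sup>2 * (norm (?G x - gradient \<psi> x))\<^sup>2 + v x * partial_deriv i \<eta> x)"
      unfolding I_def using int_v int_diff int_grad int_v\<eta>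
      by (intro integral_mono_AE) auto
    also have "\<dots> = (1/2) * I + (LINT x|?M. (v x - \<psi> x)\<^sup>2) +
        R\<^sup>2 * (LINT x|?M. (norm (?G x - gradient \<psi> x))\<^sup>2)"
      using int_v int_diff int_grad int_v\<eta> v\<eta> by (simp add: I_def)
    finally have I_le: "I \<le> 2 * ((LINT x|?M. (v x - \<psi> x)\<^sup>2) +
        R\<^sup>2 * (LINT x|?M. (norm (?G x - gradient \<psi> x))\<^sup>2))"
      by simp
    define s t where "s = (LINT x|?M. (v x - \<psi> x)\<^sup>2)" and "t = (LINT x|?M. (norm (?G x - gradient \<psi> x))\<^sup>2)"
    have st: "0 \<le> s" "0 \<le> t"
      by (simp_all add: s_def t_def)
    have "s + t < \<epsilon>\<^sup>2"
    proof -
      have "(sqrt (s + t))\<^sup>2 < \<epsilon>\<^sup>2"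
        using less st by (intro power_strict_mono) (auto simp: s_def t_def)
      then show ?thesis
        using st by simp
    qed
    then have "(1 + R\<^sup>2) * (s + t) \<le> (1 + R\<^sup>2) * \<epsilon>\<^sup>2"
      by (intro mult_left_mono) auto
    moreover have "s + R\<^sup>2 * t \<le> (1 + R\<^sup>2) * (s + t)"
      using st by (simp add: algebra_simps)
    ultimately have "2 * (s + R\<^sup>2 * t) \<le> 2 * ((1 + R\<^sup>2) * \<epsilon>\<^sup>2)"
      by (intro mult_left_mono) auto
    with I_le show ?thesis
      unfolding s_def[symmetric] t_def[symmetric] mult.assoc by (rule order_trans)
  qed
  have "I \<le> 0"
  proof (rule ccontr)
    assume "\<not> I \<le> 0"
    define C where "C = 2 * (1 + R\<^sup>2)"
    have C: "0 < C"
      by (simp add: C_def add_pos_nonneg)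
    have "I \<le> C * (sqrt (I / (2 * C)))\<^sup>2"
      using bound[of "sqrt (I / (2 * C))"] C \<open>\<not> I \<le> 0\<close> by (simp add: C_def)
    then show False
      using C \<open>\<not> I \<le> 0\<close> by simp
  qed
  moreover have "0 \<le> I"
    by (simp add: I_def)
  ultimately have "I = 0"
    by (rule antisym)
  then have "AE x in ?M. (v x)\<^sup>2 = 0"
    using integral_nonneg_eq_0_iff_AE[OF int_v] by (simp add: I_def)
  then show ?thesis
    by simp
qed

section \<open>The energy form\<close>

lemma energy_integrand_integrable:
  fixes g h :: "real^'d \<Rightarrow> real^'d"
  assumes K: "Linfty_matrix \<Omega> K" and gh: "g \<in> L2 \<Omega>" "h \<in> L2 \<Omega>"
  shows "integrable (lebesgue_on \<Omega>) (\<lambda>x. inner (K x *v g x) (h x))"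
proof -
  have "integrable (lebesgue_on \<Omega>) (\<lambda>x. K x $ i $ j * g x $ j * h x $ i)" for i j
  proof -
    obtain C where C: "AE x in lebesgue_on \<Omega>. \<bar>K x $ i $ j\<bar> \<le> C"
      and [measurable]: "(\<lambda>x. K x $ i $ j) \<in> borel_measurable (lebesgue_on \<Omega>)"
      using K unfolding Linfty_matrix_def by blast
    note L2 = L2_component[OF gh(1), of j] L2_component[OF gh(2), of i]
    note [measurable] = L2[THEN L2_measurable]
    show ?thesis
    proof (rule L2_product_bound[OF L2])
      show "AE x in lebesgue_on \<Omega>. \<bar>K x $ i $ j * g x $ j * h x $ i\<bar> \<le> C * (norm (g x $ j) * norm (h x $ i))"
        using C by eventually_elim (auto simp: abs_mult mult.assoc intro!: mult_right_mono)
    qed measurable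
  qed
  then have "integrable (lebesgue_on \<Omega>) (\<lambda>x. \<Sum>i\<in>UNIV. \<Sum>j\<in>UNIV. K x $ i $ j * g x $ j * h x $ i)"
    by (intro Bochner_Integration.integrable_sum)
  then show ?thesis
    by (simp add: inner_vec_def matrix_vector_mult_def sum_distrib_right)
qed

lemma energy_form_commute:
  assumes K: "Linfty_matrix \<Omega> K" "sym_unif_pos_def \<Omega> K" and "v \<in> H1 \<Omega>" "w \<in> H1 \<Omega>"
  shows "energy_form \<Omega> K v w = energy_form \<Omega> K w v"
  unfolding energy_form_def
proof (rule integral_cong_AE)
  have "AE x in lebesgue_on \<Omega>. Finite_Cartesian_Product.transpose (K x) = K x"
    using K(2) by (simp add: sym_unif_pos_def_def)
  then show "AE x in lebesgue_on \<Omega>. inner (K x *v weak_grad \<Omega> v x) (weak_grad \<Omega> w x) =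
      inner (K x *v weak_grad \<Omega> w x) (weak_grad \<Omega> v x)"
    by eventually_elim (metis dot_lmul_matrix inner_commute transpose_matrix_vector)
qed (use assms energy_integrand_integrable weak_grad_of_H1 in \<open>auto intro!: borel_measurable_integrable\<close>)

lemma energy_form_definite:
  assumes K: "Linfty_matrix \<Omega> K" "sym_unif_pos_def \<Omega> K" and v: "v \<in> H10 \<Omega>"
    and le0: "energy_form \<Omega> K v v \<le> 0"
  shows "AE x in lebesgue_on \<Omega>. v x = 0"
proof (rule H10_weak_grad_zero[OF v])
  let ?G = "weak_grad \<Omega> v"
  have G: "?G \<in> L2 \<Omega>"
    using v by (intro weak_grad_of_H1) (simp add: H10_def)
  obtain \<kappa> where \<kappa>: "0 < \<kappa>" "AE x in lebesgue_on \<Omega>. \<forall>\<xi>. \<kappa> * (norm \<xi>)\<^sup>2 \<le> inner (K x *v \<xi>) \<xi>"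
    using K(2) by (auto simp: sym_unif_pos_def_def)
  have int: "integrable (lebesgue_on \<Omega>) (\<lambda>x. \<kappa> * (norm (?G x))\<^sup>2)"
    by (intro integrable_mult_right L2_square_integrable G)
  have "(LINT x|lebesgue_on \<Omega>. \<kappa> * (norm (?G x))\<^sup>2) \<le> energy_form \<Omega> K v v"
    unfolding energy_form_def using \<kappa>(2)
    by (intro integral_mono_AE int energy_integrand_integrable K G) auto
  moreover have "0 \<le> (LINT x|lebesgue_on \<Omega>. \<kappa> * (norm (?G x))\<^sup>2)"
    using \<kappa>(1) by (intro integral_nonneg_AE) auto
  ultimately have "(LINT x|lebesgue_on \<Omega>. \<kappa> * (norm (?G x))\<^sup>2) = 0"
    using le0 by linarith
  then have "AE x in lebesgue_on \<Omega>. \<kappa> * (norm (?G x))\<^sup>2 = 0"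
    using \<kappa>(1) by (subst (asm) integral_nonneg_eq_0_iff_AE[OF int]) auto
  then show "AE x in lebesgue_on \<Omega>. ?G x = 0"
    using \<kappa>(1) by auto
qed

text \<open>Here \<open>v\<close> and \<open>w\<close> are only required to agree with the combinations almost everywhere, because the
elements of the finite element space are known only up to null sets.\<close>

lemma energy_form_lin_comb:
  assumes K: "Linfty_matrix \<Omega> K"
    and \<phi>: "\<And>j. j < N \<Longrightarrow> \<phi> j \<in> H1 \<Omega>"
    and v: "v \<in> H1 \<Omega>" "c \<in> carrier_vec N" "AE x in lebesgue_on \<Omega>. v x = lin_comb \<phi> c x"
    and w: "w \<in> H1 \<Omega>" "d \<in> carrier_vec N" "AE x in lebesgue_on \<Omega>. w x = lin_comb \<phi> d x"
  shows "energy_form \<Omega> K v w = scalar_prod c (galerkin_matrix \<Omega> K N \<phi> *\<^sub>v d)"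
proof -
  let ?g = "\<lambda>j. weak_grad \<Omega> (\<phi> j)"
  have int: "integrable (lebesgue_on \<Omega>) (\<lambda>x. inner (K x *v ?g j x) (?g k x))" if "j < N" "k < N" for j k
    using that by (intro energy_integrand_integrable K weak_grad_of_H1 \<phi>)
  have "AE x in lebesgue_on \<Omega>. weak_grad \<Omega> v x = (\<Sum>j<N. vec_index c j *\<^sub>R ?g j x)"
    using weak_grad_lin_comb[OF v(1,3)] v(2) \<phi> by simp
  moreover have "AE x in lebesgue_on \<Omega>. weak_grad \<Omega> w x = (\<Sum>k<N. vec_index d k *\<^sub>R ?g k x)"
    using weak_grad_lin_comb[OF w(1,3)] w(2) \<phi> by simp
  ultimately have ae: "AE x in lebesgue_on \<Omega>. inner (K x *v weak_grad \<Omega> v x) (weak_grad \<Omega> w x) =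
    (\<Sum>j<N. \<Sum>k<N. vec_index c j * vec_index d k * inner (K x *v ?g j x) (?g k x))"
    by eventually_elim
      (simp add: inner_sum_left inner_sum_right matrix_vector_mult_scaleR
        sum_distrib_left mult.assoc linear_sum[OF matrix_vector_mul_linear],
       subst sum.swap, simp add: mult.left_commute)
  have "energy_form \<Omega> K v w =
    (LINT x|lebesgue_on \<Omega>. (\<Sum>j<N. \<Sum>k<N. vec_index c j * vec_index d k * inner (K x *v ?g j x) (?g k x)))"
    unfolding energy_form_def
  proof (rule integral_cong_AE[OF _ _ ae])
    show "(\<lambda>x. inner (K x *v weak_grad \<Omega> v x) (weak_grad \<Omega> w x)) \<in> borel_measurable (lebesgue_on \<Omega>)"
      by (intro borel_measurable_integrable energy_integrand_integrable K weak_grad_of_H1 v w)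
    show "(\<lambda>x. \<Sum>j<N. \<Sum>k<N. vec_index c j * vec_index d k * inner (K x *v ?g j x) (?g k x))
        \<in> borel_measurable (lebesgue_on \<Omega>)"
      using int by (intro borel_measurable_integrable Bochner_Integration.integrable_sum integrable_mult_right) auto
  qed
  also have "\<dots> = (\<Sum>j<N. \<Sum>k<N. vec_index c j * vec_index d k * energy_form \<Omega> K (\<phi> j) (\<phi> k))"
    unfolding energy_form_def using int
    by (subst Bochner_Integration.integral_sum;
        (intro Bochner_Integration.integrable_sum integrable_mult_right)?; simp)+
  also have "\<dots> = scalar_prod c (galerkin_matrix \<Omega> K N \<phi> *\<^sub>v d)"
    using v(2) w(2)
    by (simp add: scalar_prod_def galerkin_matrix_def sum_distrib_left mult.commute mult.left_commute
        lessThan_atLeast0)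
  finally show ?thesis .
qed

end

section \<open>Coordinates with respect to a basis\<close>

lemma lin_comb_diff:
  assumes "c \<in> carrier_vec N" "d \<in> carrier_vec N"
  shows "lin_comb \<phi> (c - d) x = lin_comb \<phi> c x - lin_comb \<phi> d x"
  using assms by (simp add: lin_comb_def sum_subtractf[symmetric] left_diff_distrib)

lemma lin_comb_unit_vec:
  assumes "j < N"
  shows "lin_comb \<phi> (unit_vec N j) x = \<phi> j x"
proof -
  have "lin_comb \<phi> (unit_vec N j) x = (\<Sum>i<N. if i = j then \<phi> i x else 0)"
    unfolding lin_comb_def using assms by (intro sum.cong) (auto simp: unit_vec_def)
  with assms show ?thesis by simp
qed

lemma basis_coeff_unique:
  assumes "is_basis \<Omega> X N \<phi>" "c \<in> carrier_vec N" "d \<in> carrier_vec N"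
    and "AE x in lebesgue_on \<Omega>. v x = lin_comb \<phi> c x" "AE x in lebesgue_on \<Omega>. v x = lin_comb \<phi> d x"
  shows "c = d"
proof -
  have "AE x in lebesgue_on \<Omega>. lin_comb \<phi> (c - d) x = 0"
    using assms(4,5) by eventually_elim (simp add: lin_comb_diff[OF assms(2,3)])
  then have "c - d = 0\<^sub>v N"
    using assms unfolding is_basis_def by (metis minus_carrier_vec)
  have "vec_index c i = vec_index d i" if "i < N" for i
  proof -
    have "vec_index (c - d) i = 0"
      using that by (simp add: \<open>c - d = 0\<^sub>v N\<close>)
    then show ?thesis
      using that assms(2,3) by simp
  qed
  then show ?thesis
    using assms(2,3) by auto
qed

lemma coeff_vec_eq:
  assumes "is_basis \<Omega> X N \<phi>" "c \<in> carrier_vec N" "AE x in lebesgue_on \<Omega>. v x = lin_comb \<phi> c x"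
  shows "coeff_vec \<Omega> N \<phi> v = c"
  unfolding coeff_vec_def using assms basis_coeff_unique[OF assms(1)] by (intro the_equality) blast+

section \<open>Preconditioned conjugate gradients for a contractive preconditioner\<close>

locale spd_matrix =
  fixes A :: "real Matrix.mat" and n :: nat
  assumes carrier: "A \<in> carrier_mat n n"
    and symmetric: "\<And>x y. x \<in> carrier_vec n \<Longrightarrow> y \<in> carrier_vec n \<Longrightarrow> x \<bullet> (A *\<^sub>v y) = y \<bullet> (A *\<^sub>v x)"
    and positive: "\<And>x. x \<in> carrier_vec n \<Longrightarrow> x \<noteq> 0\<^sub>v n \<Longrightarrow> 0 < x \<bullet> (A *\<^sub>v x)"
begin

lemma mult_closed [simp]: "x \<in> carrier_vec n \<Longrightarrow> A *\<^sub>v x \<in> carrier_vec n"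
  using carrier by simp

lemma nonneg: "x \<in> carrier_vec n \<Longrightarrow> 0 \<le> x \<bullet> (A *\<^sub>v x)"
  using positive[of x] mult_closed[of x] by (cases "x = 0\<^sub>v n") auto

lemma mat_norm_sq: "x \<in> carrier_vec n \<Longrightarrow> (mat_norm A x)\<^sup>2 = x \<bullet> (A *\<^sub>v x)"
  using nonneg by (simp add: mat_norm_def)

lemma mult_diff: "x \<in> carrier_vec n \<Longrightarrow> y \<in> carrier_vec n \<Longrightarrow> A *\<^sub>v (x - y) = A *\<^sub>v x - A *\<^sub>v y"
  using carrier by (rule mult_minus_distrib_mat_vec)

lemma mult_smult: "x \<in> carrier_vec n \<Longrightarrow> A *\<^sub>v (c \<cdot>\<^sub>v x) = c \<cdot>\<^sub>v (A *\<^sub>v x)"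
  using carrier by (rule mult_mat_vec)

lemma quadratic_diff_smult:
  assumes "x \<in> carrier_vec n" "y \<in> carrier_vec n"
  shows "(x - t \<cdot>\<^sub>v y) \<bullet> (A *\<^sub>v (x - t \<cdot>\<^sub>v y)) =
    x \<bullet> (A *\<^sub>v x) - 2 * t * (y \<bullet> (A *\<^sub>v x)) + t\<^sup>2 * (y \<bullet> (A *\<^sub>v y))"
proof -
  have "A *\<^sub>v (x - t \<cdot>\<^sub>v y) = A *\<^sub>v x - t \<cdot>\<^sub>v (A *\<^sub>v y)"
    using assms by (simp add: mult_diff mult_smult)
  then have "(x - t \<cdot>\<^sub>v y) \<bullet> (A *\<^sub>v (x - t \<cdot>\<^sub>v y)) =
     x \<bullet> (A *\<^sub>v x) - t * (x \<bullet> (A *\<^sub>v y)) - t * (y \<bullet> (A *\<^sub>v x) - t * (y \<bullet> (A *\<^sub>v y)))"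
    using assms
    by (simp add: minus_scalar_prod_distrib[of _ n] scalar_prod_minus_distrib[of _ n] algebra_simps)
  then show ?thesis
    using symmetric[OF assms] by (simp add: algebra_simps power2_eq_square)
qed

lemma quadratic_diff:
  assumes "x \<in> carrier_vec n" "y \<in> carrier_vec n"
  shows "(x - y) \<bullet> (A *\<^sub>v (x - y)) = x \<bullet> (A *\<^sub>v x) - 2 * (y \<bullet> (A *\<^sub>v x)) + y \<bullet> (A *\<^sub>v y)"
  using quadratic_diff_smult[OF assms, of 1] by simp

lemma mult_injective:
  assumes "x \<in> carrier_vec n" "y \<in> carrier_vec n" "A *\<^sub>v x = A *\<^sub>v y"
  shows "x = y"
proof -
  have "(x - y) \<bullet> (A *\<^sub>v (x - y)) = 0"
    using assms by (simp add: mult_diff scalar_prod_minus_distrib[of _ n])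
  then have diff: "x - y = 0\<^sub>v n"
    using positive[of "x - y"] assms by force
  show ?thesis
  proof (rule eq_vecI)
    fix i assume "i < dim_vec y"
    then have "vec_index (x - y) i = 0"
      using diff assms by simp
    then show "vec_index x i = vec_index y i"
      using \<open>i < dim_vec y\<close> by simp
  qed (use assms in simp)
qed

text \<open>Expanding the square of the contraction estimate leaves
\<open>(1 - q\<^sup>2) |e|\<^sup>2 + |s|\<^sup>2 \<le> 2 (s, e)\<close>, all in the inner product of \<open>A\<close>. So a contractive
preconditioner, however nonlinear, is positive along the residual, and this is what keeps the
denominators of the iteration away from zero.\<close>

lemma pairing_pos_if_contractive:
  assumes "e \<in> carrier_vec n" "s \<in> carrier_vec n" "e \<noteq> 0\<^sub>v n"
    and "mat_norm A (e - s) \<le> q * mat_norm A e" "0 < q" "q < 1"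
  shows "0 < s \<bullet> (A *\<^sub>v e)"
proof -
  have "(mat_norm A (e - s))\<^sup>2 \<le> (q * mat_norm A e)\<^sup>2"
    by (rule power_mono) (use assms nonneg[of "e - s"] in \<open>auto simp: mat_norm_def\<close>)
  also have "\<dots> = q\<^sup>2 * (e \<bullet> (A *\<^sub>v e))"
    using assms by (simp add: power_mult_distrib mat_norm_sq)
  also have "\<dots> < 1 * (e \<bullet> (A *\<^sub>v e))"
    using assms positive[of e] by (intro mult_strict_right_mono) (auto simp: power_less_one_iff)
  finally show ?thesis
    using assms quadratic_diff[of e s] nonneg[of s] by (simp add: mat_norm_sq)
qed

lemma line_search_optimal:
  assumes e: "e \<in> carrier_vec n" and p: "p \<in> carrier_vec n" and p0: "p \<bullet> (A *\<^sub>v p) \<noteq> 0"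
    and \<alpha>: "\<alpha> = (p \<bullet> (A *\<^sub>v e)) / (p \<bullet> (A *\<^sub>v p))"
  shows "mat_norm A (e - \<alpha> \<cdot>\<^sub>v p) \<le> mat_norm A (e - p)"
proof -
  define a where "a = p \<bullet> (A *\<^sub>v p)"
  have a: "a > 0"
    using nonneg[OF p] p0 by (simp add: a_def)
  have pe: "p \<bullet> (A *\<^sub>v e) = \<alpha> * a"
    using \<alpha> p0 by (simp add: a_def)
  have "0 \<le> a * (1 - \<alpha>)\<^sup>2"
    using a by simp
  then have "(e - \<alpha> \<cdot>\<^sub>v p) \<bullet> (A *\<^sub>v (e - \<alpha> \<cdot>\<^sub>v p)) \<le> (e - p) \<bullet> (A *\<^sub>v (e - p))"
    unfolding quadratic_diff_smult[OF e p] quadratic_diff[OF e p] pe a_def[symmetric]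
    by (simp add: power2_eq_square algebra_simps)
  then show ?thesis
    by (simp add: mat_norm_def)
qed

text \<open>The direction \<open>p\<close> differs from the preconditioned residual \<open>B r\<close> by a multiple of the previous
direction, and all that matters about this difference is that it is orthogonal, in the inner product
of \<open>A\<close>, both to \<open>p\<close> and to the error \<open>xs - x\<close>. Formulated without reference to the previous
step, the property holds at the start, where the difference vanishes, and survives each step.\<close>

definition conjugate_state ::
  "(real Matrix.vec \<Rightarrow> real Matrix.vec) \<Rightarrow> real Matrix.vec \<Rightarrow>
   real Matrix.vec \<times> real Matrix.vec \<times> real Matrix.vec \<Rightarrow> bool" where
  "conjugate_state B xs = (\<lambda>(x, r, p).
     x \<in> carrier_vec n \<and> p \<in> carrier_vec n \<and> r = A *\<^sub>v (xs - x) \<and>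
     (p - B r) \<bullet> (A *\<^sub>v p) = 0 \<and> (p - B r) \<bullet> r = 0)"

context
  fixes B :: "real Matrix.vec \<Rightarrow> real Matrix.vec" and xs :: "real Matrix.vec" and q :: real
  assumes xs: "xs \<in> carrier_vec n"
    and B: "B \<in> carrier_vec n \<rightarrow> carrier_vec n"
    and q: "0 < q" "q < 1"
    and contractive: "\<And>c. c \<in> carrier_vec n \<Longrightarrow> mat_norm A (c - B (A *\<^sub>v c)) \<le> q * mat_norm A c"
begin

text \<open>Orthogonality of \<open>p - B r\<close> to the error gives \<open>(p, r) = (B r, r)\<close>, which is positive by
contractivity. In particular \<open>p\<close> cannot vanish.\<close>

lemma conjugate_state_divisors:
  assumes inv: "conjugate_state B xs (x, r, p)" and r: "r \<noteq> 0\<^sub>v n"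
  shows "0 < B r \<bullet> r" "p \<bullet> r = B r \<bullet> r" "0 < p \<bullet> (A *\<^sub>v p)"
proof -
  let ?e = "xs - x"
  have car: "x \<in> carrier_vec n" "p \<in> carrier_vec n" "?e \<in> carrier_vec n"
    and r_eq: "r = A *\<^sub>v ?e" and rc: "r \<in> carrier_vec n"
    using inv xs by (auto simp: conjugate_state_def)
  have Br: "B r \<in> carrier_vec n"
    using B rc by auto
  have e0: "?e \<noteq> 0\<^sub>v n"
    using r r_eq carrier by auto
  show pos: "0 < B r \<bullet> r"
    using pairing_pos_if_contractive[OF car(3) Br e0 _ q] contractive[OF car(3)] by (simp add: r_eq)
  show pr: "p \<bullet> r = B r \<bullet> r"
    using inv car rc Br by (auto simp: conjugate_state_def minus_scalar_prod_distrib[of _ n])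
  have "p \<noteq> 0\<^sub>v n"
    using pos pr rc by auto
  then show "0 < p \<bullet> (A *\<^sub>v p)"
    using positive car by blast
qed

text \<open>The choice of \<open>\<alpha>\<close> makes the new residual orthogonal to \<open>p\<close>, because \<open>(B r, r) = (p, r)\<close>. The choice
of \<open>\<beta>\<close> makes the new direction \<open>A\<close>-orthogonal to \<open>p\<close>: the update of the residual says
\<open>\<alpha> A p = r - r'\<close>, so the numerator of \<open>\<beta>\<close> equals \<open>- \<alpha> (B r', A p)\<close>. For a nonlinear \<open>B\<close> this
depends on the term \<open>(B r', r)\<close> in that numerator.\<close>

lemma gpcg_step_conjugate_state:
  assumes inv: "conjugate_state B xs st"
  shows "conjugate_state B xs (gpcg_step A B st)"
proof -
  obtain x r p where st: "st = (x, r, p)"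
    by (cases st)
  show ?thesis
  proof (cases "r = 0\<^sub>v n")
    case True
    then show ?thesis
      using inv carrier by (simp add: st gpcg_step_def)
  next
    case False
    let ?e = "xs - x"
    have car: "x \<in> carrier_vec n" "p \<in> carrier_vec n" "?e \<in> carrier_vec n"
      and r_eq: "r = A *\<^sub>v ?e" and rc: "r \<in> carrier_vec n"
      using inv xs by (auto simp: conjugate_state_def st)
    note d = conjugate_state_divisors[OF inv[unfolded st] False]
    define \<alpha> where "\<alpha> = (B r \<bullet> r) / (mat_norm A p)\<^sup>2"
    define r' where "r' = r - \<alpha> \<cdot>\<^sub>v (A *\<^sub>v p)"
    define \<beta> where "\<beta> = (B r' \<bullet> r' - B r' \<bullet> r) / (B r \<bullet> r)"
    have step: "gpcg_step A B st = (x + \<alpha> \<cdot>\<^sub>v p, r', B r' + \<beta> \<cdot>\<^sub>v p)"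
      using False carrier by (simp add: st gpcg_step_def Let_def \<alpha>_def r'_def \<beta>_def)
    have \<alpha>: "\<alpha> * (p \<bullet> (A *\<^sub>v p)) = B r \<bullet> r" "\<alpha> \<noteq> 0"
      using d car by (simp_all add: \<alpha>_def mat_norm_sq)
    have \<beta>: "\<beta> * (B r \<bullet> r) = B r' \<bullet> r' - B r' \<bullet> r"
      using d by (simp add: \<beta>_def)
    have rc': "r' \<in> carrier_vec n"
      using car rc by (simp add: r'_def)
    have Br': "B r' \<in> carrier_vec n"
      using B rc' by auto
    have "xs - (x + \<alpha> \<cdot>\<^sub>v p) = ?e - \<alpha> \<cdot>\<^sub>v p"
      using xs car by auto
    then have resid: "r' = A *\<^sub>v (xs - (x + \<alpha> \<cdot>\<^sub>v p))"
      using car by (simp add: r'_def r_eq mult_diff mult_smult)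
    have diff: "B r' + \<beta> \<cdot>\<^sub>v p - B r' = \<beta> \<cdot>\<^sub>v p"
      using Br' car by auto
    have pr': "p \<bullet> r' = 0"
      using car rc d \<alpha> by (simp add: r'_def scalar_prod_minus_distrib[of _ n])
    have Bp: "B r' \<bullet> r' = B r' \<bullet> r - \<alpha> * (B r' \<bullet> (A *\<^sub>v p))"
      using car rc Br' by (subst (2) r'_def) (simp add: scalar_prod_minus_distrib[of _ n])
    have "\<alpha> * (B r' \<bullet> (A *\<^sub>v p) + \<beta> * (p \<bullet> (A *\<^sub>v p))) = 0"
      using Bp \<beta> mult.left_commute[of \<alpha> \<beta> "p \<bullet> (A *\<^sub>v p)"] unfolding distrib_left \<alpha>(1)
      by linarith
    then have "(B r' + \<beta> \<cdot>\<^sub>v p) \<bullet> (A *\<^sub>v p) = 0"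
      using \<alpha>(2) car Br' by (simp add: add_scalar_prod_distrib[of _ n])
    then have "p \<bullet> (A *\<^sub>v (B r' + \<beta> \<cdot>\<^sub>v p)) = 0"
      using symmetric[of p "B r' + \<beta> \<cdot>\<^sub>v p"] car Br' by simp
    then show ?thesis
      using car Br' rc' pr' resid[symmetric] unfolding step conjugate_state_def prod.case diff
      by simp
  qed
qed

lemma gpcg_conjugate_state:
  assumes "x0 \<in> carrier_vec n"
  shows "conjugate_state B xs (gpcg A B (A *\<^sub>v xs) x0 k)"
proof (induction k)
  case 0
  have r: "A *\<^sub>v xs - A *\<^sub>v x0 = A *\<^sub>v (xs - x0)"
    using xs assms by (simp add: mult_diff)
  have "B (A *\<^sub>v (xs - x0)) \<in> carrier_vec n"
    using B xs assms by auto
  then show ?case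
    using xs assms by (simp add: gpcg_def conjugate_state_def r)
next
  case (Suc k)
  then show ?case
    using gpcg_step_conjugate_state by (simp add: gpcg_def)
qed

text \<open>With \<open>e\<close> the error, \<open>e - B r = (e - p) + (p - B r)\<close> is an \<open>A\<close>-orthogonal sum, hence
\<open>|e - p| \<le> |e - B r| \<le> q |e|\<close>. The method does at least as well as the trial step \<open>e - p\<close>, since it
minimizes the error along \<open>p\<close>.\<close>

lemma gpcg_step_contractive:
  assumes inv: "conjugate_state B xs st"
  shows "mat_norm A (xs - fst (gpcg_step A B st)) \<le> q * mat_norm A (xs - fst st)"
proof -
  obtain x r p where st: "st = (x, r, p)"
    by (cases st)
  let ?e = "xs - x"
  have car: "x \<in> carrier_vec n" "p \<in> carrier_vec n" "?e \<in> carrier_vec n"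
    and r_eq: "r = A *\<^sub>v ?e" and rc: "r \<in> carrier_vec n"
    and conj: "(p - B r) \<bullet> (A *\<^sub>v p) = 0" "(p - B r) \<bullet> (A *\<^sub>v ?e) = 0"
    using inv xs by (auto simp: conjugate_state_def st)
  have Br: "B r \<in> carrier_vec n"
    using B rc by auto
  show ?thesis
  proof (cases "r = 0\<^sub>v n")
    case True
    then have "?e \<bullet> (A *\<^sub>v ?e) = 0"
      using car(3) r_eq by (metis scalar_prod_right_zero)
    then show ?thesis
      using True carrier by (simp add: st gpcg_step_def mat_norm_def)
  next
    case False
    note d = conjugate_state_divisors[OF inv[unfolded st] False]
    define \<alpha> where "\<alpha> = (B r \<bullet> r) / (mat_norm A p)\<^sup>2"
    define w where "w = p - B r"
    have w: "w \<in> carrier_vec n"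
      using car Br by (simp add: w_def)
    have \<alpha>: "\<alpha> = (p \<bullet> (A *\<^sub>v ?e)) / (p \<bullet> (A *\<^sub>v p))"
      using d car by (simp add: \<alpha>_def mat_norm_sq r_eq)
    have "xs - fst (gpcg_step A B st) = ?e - \<alpha> \<cdot>\<^sub>v p"
      using False carrier xs car by (auto simp add: st gpcg_step_def Let_def \<alpha>_def)
    then have "mat_norm A (xs - fst (gpcg_step A B st)) \<le> mat_norm A (?e - p)"
      using line_search_optimal[OF car(3,2) _ \<alpha>] d by simp
    also have "\<dots> \<le> mat_norm A (?e - B r)"
    proof -
      have "(w \<bullet> (A *\<^sub>v (?e - p))) = 0"
        using conj w car by (simp add: mult_diff scalar_prod_minus_distrib[of _ n] w_def)
      \<comment> \<open>The subtracted multiple \<open>-1\<close> turns the expansion of a difference into that of a sum.\<close>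
      moreover have "?e - B r = (?e - p) - (-1) \<cdot>\<^sub>v w"
        using car Br xs by (auto simp: w_def)
      ultimately have "(?e - B r) \<bullet> (A *\<^sub>v (?e - B r)) = (?e - p) \<bullet> (A *\<^sub>v (?e - p)) + w \<bullet> (A *\<^sub>v w)"
        using quadratic_diff_smult[of "?e - p" w "-1"] w car by simp
      then show ?thesis
        using nonneg[OF w] by (simp add: mat_norm_def)
    qed
    also have "\<dots> \<le> q * mat_norm A ?e"
      using contractive[OF car(3)] by (simp add: r_eq)
    finally show ?thesis
      by (simp add: st)
  qed
qed

theorem gpcg_contraction:
  assumes "x0 \<in> carrier_vec n"
  shows "gpcg_well_defined A B (A *\<^sub>v xs) x0"
    and "mat_norm A (xs - gpcg_iterate A B (A *\<^sub>v xs) x0 (Suc k))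
          \<le> q * mat_norm A (xs - gpcg_iterate A B (A *\<^sub>v xs) x0 k)"
    and "gpcg_iterate A B (A *\<^sub>v xs) x0 k \<in> carrier_vec n"
proof -
  note inv = gpcg_conjugate_state[OF assms]
  show "gpcg_well_defined A B (A *\<^sub>v xs) x0"
    unfolding gpcg_well_defined_def
  proof (intro allI, clarify)
    fix k x r p
    assume "gpcg A B (A *\<^sub>v xs) x0 k = (x, r, p)" "r \<noteq> 0\<^sub>v (dim_row A)"
    then show "mat_norm A p \<noteq> 0 \<and> B r \<bullet> r \<noteq> 0"
      using inv[of k] conjugate_state_divisors[of x r p] carrier by (auto simp: mat_norm_def)
  qed
  show "mat_norm A (xs - gpcg_iterate A B (A *\<^sub>v xs) x0 (Suc k))
          \<le> q * mat_norm A (xs - gpcg_iterate A B (A *\<^sub>v xs) x0 k)"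
    using gpcg_step_contractive[OF inv[of k]] by (simp add: gpcg_iterate_def gpcg_def)
  show "gpcg_iterate A B (A *\<^sub>v xs) x0 k \<in> carrier_vec n"
    using inv[of k] by (auto simp: gpcg_iterate_def conjugate_state_def split: prod.splits)
qed

end

end

section \<open>Contraction of the Galerkin error\<close>

theorem proposition3p4:
  fixes \<Omega> :: "(real^'d) set"
    and f :: "real^'d \<Rightarrow> real"
    and K :: "real^'d \<Rightarrow> real^'d^'d"
    and \<T> :: "nat \<Rightarrow> 'd tagged_simplex set"
    and l p N :: nat
    and X :: "(real^'d \<Rightarrow> real) set"
    and \<phi> :: "nat \<Rightarrow> real^'d \<Rightarrow> real"
    and u_star :: "real^'d \<Rightarrow> real"
    and u :: "nat \<Rightarrow> real^'d \<Rightarrow> real"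
    and S :: "(real^'d \<Rightarrow> real) \<Rightarrow> (real^'d \<Rightarrow> real)"
    and q :: real
    and A :: "real Matrix.mat"
    and b x_star x0 :: "real Matrix.vec"
    and B :: "real Matrix.vec \<Rightarrow> real Matrix.vec"
  assumes dim: "CARD('d) \<in> {1, 2, 3}"
    and domain: "bounded_lipschitz_domain \<Omega>"
    and f: "f \<in> L2 \<Omega>"
    and K: "Linfty_matrix \<Omega> K" "sym_unif_pos_def \<Omega> K"
    and meshes: "nvb_mesh_sequence \<Omega> \<T>"
    and p: "p \<ge> 1"
    and X: "X = fe_space \<Omega> (\<T> l) p"
    and basis: "is_basis \<Omega> X N \<phi>"
    and u_star: "galerkin_solution \<Omega> K f X u_star"
    and A: "A = galerkin_matrix \<Omega> K N \<phi>"
    and b: "b = galerkin_rhs \<Omega> f N \<phi>"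
    and x_star: "x_star \<in> carrier_vec N" "A *\<^sub>v x_star = b"
    and S: "S \<in> X \<rightarrow> X"
    and solver: "\<forall>k. u k \<in> X"
      "\<forall>k. AE x in lebesgue_on \<Omega>. u (Suc k) x - u k x = S (\<lambda>y. u_star y - u k y) x"
    and q: "0 < q" "q < 1"
    and contractive: "\<forall>v\<in>X. energy_norm \<Omega> K (\<lambda>x. v x - S v x) \<le> q * energy_norm \<Omega> K v"
    and B: "B \<in> carrier_vec N \<rightarrow> carrier_vec N"
      "\<forall>v\<in>X. coeff_vec \<Omega> N \<phi> (S v) = B (A *\<^sub>v coeff_vec \<Omega> N \<phi> v)"
    and x0: "x0 \<in> carrier_vec N"
  shows "gpcg_well_defined A B b x0 \<and>
    (\<forall>k. mat_norm A (x_star - gpcg_iterate A B b x0 (Suc k))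
          \<le> q * mat_norm A (x_star - gpcg_iterate A B b x0 k)) \<and>
    (AE x in lebesgue_on \<Omega>. u_star x = lin_comb \<phi> x_star x) \<and>
    (\<forall>k. energy_norm \<Omega> K (\<lambda>x. u_star x - lin_comb \<phi> (gpcg_iterate A B b x0 (Suc k)) x)
          \<le> q * energy_norm \<Omega> K (\<lambda>x. u_star x - lin_comb \<phi> (gpcg_iterate A B b x0 k) x))"
proof -
  interpret bounded_open_set \<Omega>
    using domain by unfold_locales (auto simp: bounded_lipschitz_domain_def)
  have X_iff: "v \<in> X \<longleftrightarrow> (\<exists>c\<in>carrier_vec N. AE x in lebesgue_on \<Omega>. v x = lin_comb \<phi> c x)" for v
    using basis by (auto simp: is_basis_def)
  have X_H10: "v \<in> H10 \<Omega>" and X_H1: "v \<in> H1 \<Omega>" if "v \<in> X" for v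
    using that by (auto simp: X fe_space_def H10_def)
  have lin_comb_X: "lin_comb \<phi> c \<in> X" if "c \<in> carrier_vec N" for c
    using that by (auto simp: X_iff)
  have \<phi>_X: "\<phi> j \<in> X" if "j < N" for j
    using that by (auto simp: X_iff lin_comb_unit_vec intro!: bexI[of _ "unit_vec N j"])
  have energy_form_coeff: "energy_form \<Omega> K v w = scalar_prod c (A *\<^sub>v d)"
    if "c \<in> carrier_vec N" "AE x in lebesgue_on \<Omega>. v x = lin_comb \<phi> c x"
      "d \<in> carrier_vec N" "AE x in lebesgue_on \<Omega>. w x = lin_comb \<phi> d x" for v w c d
    unfolding A using that by (intro energy_form_lin_comb K X_H1 \<phi>_X) (auto simp: X_iff)
  have energy_norm_coeff: "energy_norm \<Omega> K v = mat_norm A c"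
    if "c \<in> carrier_vec N" "AE x in lebesgue_on \<Omega>. v x = lin_comb \<phi> c x" for v c
    using energy_form_coeff[OF that that] by (simp add: energy_norm_def mat_norm_def)
  interpret spd_matrix A N
  proof
    show "A \<in> carrier_mat N N"
      by (simp add: A galerkin_matrix_def)
    show "scalar_prod c (A *\<^sub>v d) = scalar_prod d (A *\<^sub>v c)"
      if cd: "c \<in> carrier_vec N" "d \<in> carrier_vec N" for c d
    proof -
      have "energy_form \<Omega> K (lin_comb \<phi> c) (lin_comb \<phi> d) = energy_form \<Omega> K (lin_comb \<phi> d) (lin_comb \<phi> c)"
        by (intro energy_form_commute K X_H1 lin_comb_X cd)
      then show ?thesis
        using cd by (simp add: energy_form_coeff)
    qed
    show "0 < scalar_prod c (A *\<^sub>v c)" if c: "c \<in> carrier_vec N" and "c \<noteq> 0\<^sub>v N" for c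
    proof (rule ccontr)
      assume "\<not> 0 < scalar_prod c (A *\<^sub>v c)"
      then have "energy_form \<Omega> K (lin_comb \<phi> c) (lin_comb \<phi> c) \<le> 0"
        using c by (simp add: energy_form_coeff)
      then have "AE x in lebesgue_on \<Omega>. lin_comb \<phi> c x = 0"
        by (rule energy_form_definite[OF K X_H10[OF lin_comb_X[OF c]]])
      then show False
        using basis that by (auto simp: is_basis_def)
    qed
  qed
  have u_star_coeff: "AE x in lebesgue_on \<Omega>. u_star x = lin_comb \<phi> x_star x"
  proof -
    have u_X: "u_star \<in> X"
      using u_star by (simp add: galerkin_solution_def)
    then obtain c where c: "c \<in> carrier_vec N" "AE x in lebesgue_on \<Omega>. u_star x = lin_comb \<phi> c x"
      by (auto simp: X_iff)
    have "A *\<^sub>v c = b"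
    proof (rule eq_vecI)
      show "dim_vec (A *\<^sub>v c) = dim_vec b"
        by (simp add: A b galerkin_matrix_def galerkin_rhs_def)
      fix j assume "j < dim_vec b"
      then have j: "j < N"
        by (simp add: b galerkin_rhs_def)
      have "vec_index (A *\<^sub>v c) j = scalar_prod (unit_vec N j) (A *\<^sub>v c)"
        using j mult_closed[OF c(1)] by simp
      also have "\<dots> = energy_form \<Omega> K (\<phi> j) u_star"
        using j c by (intro energy_form_coeff[symmetric]) (auto simp: lin_comb_unit_vec)
      also have "\<dots> = energy_form \<Omega> K u_star (\<phi> j)"
        using j u_X by (intro energy_form_commute K X_H1 \<phi>_X)
      also have "\<dots> = vec_index b j"
        using u_star \<phi>_X[OF j] j by (simp add: galerkin_solution_def b galerkin_rhs_def)
      finally show "vec_index (A *\<^sub>v c) j = vec_index b j" .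
    qed
    then have "A *\<^sub>v c = A *\<^sub>v x_star"
      using x_star by simp
    then have "c = x_star"
      by (rule mult_injective[OF c(1) x_star(1)])
    with c show ?thesis by simp
  qed
  have B_contractive: "mat_norm A (c - B (A *\<^sub>v c)) \<le> q * mat_norm A c" if c: "c \<in> carrier_vec N" for c
  proof -
    let ?v = "lin_comb \<phi> c"
    have v: "?v \<in> X" "S ?v \<in> X"
      using lin_comb_X[OF c] S by auto
    obtain s where s: "s \<in> carrier_vec N" "AE x in lebesgue_on \<Omega>. S ?v x = lin_comb \<phi> s x"
      using v(2) by (auto simp: X_iff)
    have "B (A *\<^sub>v c) = s"
      using B(2) v(1) coeff_vec_eq[OF basis s] coeff_vec_eq[OF basis c, of ?v] by auto
    moreover have "AE x in lebesgue_on \<Omega>. ?v x - S ?v x = lin_comb \<phi> (c - s) x"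
      using s(2) by eventually_elim (simp add: lin_comb_diff[OF c s(1)])
    then have "energy_norm \<Omega> K (\<lambda>x. ?v x - S ?v x) = mat_norm A (c - s)"
      using c s by (intro energy_norm_coeff) auto
    moreover have "energy_norm \<Omega> K ?v = mat_norm A c"
      using c by (intro energy_norm_coeff) auto
    ultimately show ?thesis
      using contractive v(1) by metis
  qed
  note gpcg = gpcg_contraction[OF x_star(1) B(1) q B_contractive x0, unfolded x_star(2)]
  have error_norm: "energy_norm \<Omega> K (\<lambda>x. u_star x - lin_comb \<phi> (gpcg_iterate A B b x0 k) x) =
      mat_norm A (x_star - gpcg_iterate A B b x0 k)" for k
  proof (rule energy_norm_coeff)
    show "x_star - gpcg_iterate A B b x0 k \<in> carrier_vec N"
      using x_star(1) gpcg(3) by simp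
    show "AE x in lebesgue_on \<Omega>. u_star x - lin_comb \<phi> (gpcg_iterate A B b x0 k) x =
        lin_comb \<phi> (x_star - gpcg_iterate A B b x0 k) x"
      using u_star_coeff by eventually_elim (simp add: lin_comb_diff[OF x_star(1) gpcg(3)])
  qed
  show ?thesis
    using gpcg(1,2) u_star_coeff by (simp add: error_norm)
qed

end
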